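(* Let $p(\cdot,\cdot)$ be a transient transition kernel on a countable state space $\mathcal S$. Suppose that $\Pi$ is a group of permutations of $\mathcal S$ that acts transitively (i.e., with a single orbit) and satisfies $p(\pi x,\pi y)=p(x,y)$ for all $\pi\in\Pi$ and $x,y\in\mathcal S$. Fix $o\in\mathcal S$ and suppose that $$\sum_{z\in\mathcal S}G(o,z)^2=\infty .$$ Then two independent Markov chains $X=\langle X_m\rangle_{m\ge0}$ and $Y=\langle Y_n\rangle_{n\ge0}$ with transition probabilities $p(\cdot,\cdot)$ and initial state $o$ have infinitely many intersections almost surely. Moreover, almost surely $Y_n$ is in $\mathrm{LE}(\langle X_m\rangle_{m\ge0})$ for infinitely many $n$.
   Context: The Green function is $G(x,y):=\sum_{n=0}^\infty\mathbf P_x[X_n=y]$, where $\langle X_n\rangle$ is the Markov chain with transition probabilities $p$ started at $x$. The kernel is transient if every state is transient (so almost surely each state is visited only finitely often). "$X$ and $Y$ have infinitely many intersections" means that the set $\{X_m : m\ge0\}\cap\{Y_n : n\ge0\}$ is infinite (for transient chains this is a.s. equivalent to there being infinitely many pairs $(m,n)$ with $X_m=Y_n$). Loop-erasure: let $\gamma=\langle v_0,v_1,v_2,\ldots\rangle$ be a finite or infinite sequence in $\mathcal S$ in which each element of $\mathcal S$ occurs only finitely often. The loop-erasure $\mathrm{LE}(\gamma)=\langle u_0,u_1,u_2,\ldots\rangle$ is constructed inductively: set $u_0:=v_0$. If $u_j$ has been chosen, let $k$ be the last index such that $v_k=u_j$. If $v_k$ is the last element of $\gamma$, then $\mathrm{LE}(\gamma):=\langle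 u_0,\dots,u_j\rangle$; otherwise set $u_{j+1}:=v_{k+1}$ and continue. $\mathrm{LE}(\gamma)$ stands both for this sequence and for the set of its elements. *)

theory Defs
  imports "HOL-Probability.Probability" "HOL-Algebra.Bij"
begin

(* A transition kernel on a countable state space 's is a map p :: 's => 's pmf;
   p(x,y) is pmf (p x) y.  Every row is a probability distribution (no killing). *)

definition markov_chain ::
    "'w measure \<Rightarrow> ('s \<Rightarrow> 's pmf) \<Rightarrow> 's \<Rightarrow> (nat \<Rightarrow> 'w \<Rightarrow> 's) \<Rightarrow> bool" where
  "markov_chain M p x X \<longleftrightarrow>
     (\<forall>n. X n \<in> measurable M (count_space UNIV)) \<and>
     (AE \<omega> in M. X 0 \<omega> = x) \<and>
     (\<forall>n s y. \<P>(\<omega> in M. \<forall>i\<le>n. X i \<omega> = s i) > 0 \<longrightarrow>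
        \<P>(\<omega> in M. X (Suc n) \<omega> = y \<bar> \<forall>i\<le>n. X i \<omega> = s i) = pmf (p (s n)) y)"

abbreviation path_space :: "(nat \<Rightarrow> 's) measure" where
  "path_space \<equiv> Pi\<^sub>M UNIV (\<lambda>_. count_space UNIV)"

(* Conditional law of coordinate n given the coordinates 0, ..., n - 1. *)
fun chain_step :: "('s \<Rightarrow> 's pmf) \<Rightarrow> 's \<Rightarrow> nat \<Rightarrow> (nat \<Rightarrow> 's) \<Rightarrow> 's measure" where
  "chain_step p x 0 \<omega> = measure_pmf (return_pmf x)"
| "chain_step p x (Suc n) \<omega> = measure_pmf (p (\<omega> n))"

(* The law P_x of the chain started at x, on sequences of states; the chain itself is
   given by the coordinates (see markov_chain_path_law below).  This is PF.lim of the
   Ionescu_Tulcea locale, written out. *)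
definition path_law :: "('s :: countable \<Rightarrow> 's pmf) \<Rightarrow> 's \<Rightarrow> (nat \<Rightarrow> 's) measure" where
  "path_law p x = projective_family.lim UNIV
     (Ionescu_Tulcea.CI (chain_step p x) (\<lambda>_. count_space UNIV)) (\<lambda>_. count_space UNIV)"

definition green :: "('s :: countable \<Rightarrow> 's pmf) \<Rightarrow> 's \<Rightarrow> 's \<Rightarrow> ennreal" where
  "green p x y = (\<Sum>n. emeasure (path_law p x) {\<omega> \<in> space (path_law p x). \<omega> n = y})"

definition transient_state :: "('s :: countable \<Rightarrow> 's pmf) \<Rightarrow> 's \<Rightarrow> bool" where
  "transient_state p x \<longleftrightarrow> \<P>(\<omega> in path_law p x. \<exists>n>0. \<omega> n = x) < 1"

definition transient_kernel :: "('s :: countable \<Rightarrow> 's pmf) \<Rightarrow> bool" where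
  "transient_kernel p \<longleftrightarrow> (\<forall>x. transient_state p x)"

(* Loop-erasure of an infinite sequence; meaningful when every element occurs only
   finitely often, in which case no index is the last one and the result is infinite. *)
primrec loop_erasure :: "(nat \<Rightarrow> 's) \<Rightarrow> nat \<Rightarrow> 's" where
  "loop_erasure v 0 = v 0"
| "loop_erasure v (Suc j) = v (Suc (GREATEST k. v k = loop_erasure v j))"

lemma Ionescu_Tulcea_chain_step:
  fixes p :: "'s :: countable \<Rightarrow> 's pmf"
  shows "Ionescu_Tulcea (chain_step p x) (\<lambda>_. count_space UNIV)"
proof (rule Ionescu_Tulcea.intro)
  fix n
  show "chain_step p x n \<in> measurable (Pi\<^sub>M {0..<n} (\<lambda>_. count_space UNIV))
          (subprob_algebra (count_space UNIV))"
  proof (cases n)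
    case 0
    have "chain_step p x 0 = (\<lambda>_. measure_pmf (return_pmf x))"
      by (rule ext) simp
    then show ?thesis
      using 0 by (simp add: space_subprob_algebra prob_space_imp_subprob_space
            prob_space_measure_pmf)
  next
    case (Suc m)
    have "(\<lambda>\<omega>. \<omega> m) \<in> measurable (Pi\<^sub>M {0..<n} (\<lambda>_. count_space UNIV))
            (count_space (UNIV :: 's set))"
      using Suc by (intro measurable_component_singleton) auto
    moreover have "(\<lambda>y. measure_pmf (p y)) \<in> measurable (count_space UNIV)
        (subprob_algebra (count_space UNIV))"
      by (simp add: space_subprob_algebra prob_space_imp_subprob_space
            prob_space_measure_pmf)
    ultimately have "(\<lambda>\<omega>. measure_pmf (p (\<omega> m))) \<in> measurable
        (Pi\<^sub>M {0..<n} (\<lambda>_. count_space UNIV)) (subprob_algebra (count_space UNIV))"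
      by (rule measurable_compose)
    moreover have "chain_step p x n = (\<lambda>\<omega>. measure_pmf (p (\<omega> m)))"
      using Suc by (intro ext) simp
    ultimately show ?thesis
      by simp
  qed
next
  show "prob_space (chain_step p x n \<omega>)" for n \<omega>
    by (cases n) (simp_all add: prob_space_measure_pmf)
qed

context
  fixes p :: "'s :: countable \<Rightarrow> 's pmf" and x :: 's
begin

interpretation IT: Ionescu_Tulcea "chain_step p x" "\<lambda>_. count_space UNIV"
  by (rule Ionescu_Tulcea_chain_step)

lemma path_law_eq: "path_law p x = IT.PF.lim"
  by (simp add: path_law_def)

lemma sets_path_law: "sets (path_law p x) = sets path_space"
  by (simp add: path_law_eq)

lemma space_path_law: "space (path_law p x) = UNIV"
  by (simp add: path_law_eq space_PiM)

lemma emeasure_path_law_init: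
  assumes "A \<in> sets (Pi\<^sub>M {0..<n} (\<lambda>_. count_space UNIV))"
  shows "emeasure (path_law p x) {\<omega>. restrict \<omega> {0..<n} \<in> A} = emeasure (IT.C 0 n (\<lambda>_. undefined)) A"
proof -
  have "{\<omega>. restrict \<omega> {0..<n} \<in> A} = IT.PF.emb UNIV {0..<n} A"
    by (auto simp: prod_emb_def space_PiM)
  then have "emeasure (path_law p x) {\<omega>. restrict \<omega> {0..<n} \<in> A} = emeasure (IT.CI {0..<n}) A"
    using IT.lim[OF _ assms] by (simp add: path_law_eq)
  also have "\<dots> = emeasure (IT.C 0 n (\<lambda>_. undefined)) (IT.PF.emb {0..<n} {0..<n} A)"
    using assms by (intro IT.emeasure_CI) auto
  also have "IT.PF.emb {0..<n} {0..<n} A = A"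
    using assms by (intro prod_emb_id) (use sets.sets_into_space[OF assms] in \<open>simp_all add: space_PiM\<close>)
  finally show ?thesis .
qed

lemma prob_space_path_law: "prob_space (path_law p x)"
proof
  have A: "space (Pi\<^sub>M {0..<0::nat} (\<lambda>_. count_space UNIV)) \<in>
      sets (Pi\<^sub>M {0..<0::nat} (\<lambda>_. count_space (UNIV :: 's set)))"
    by (rule sets.top)
  interpret C: prob_space "IT.C 0 0 (\<lambda>_. undefined)"
    by (rule IT.prob_space_C) (simp add: space_PiM)
  have sp: "space (IT.C 0 0 (\<lambda>_. undefined)) = space (Pi\<^sub>M {0..<0::nat} (\<lambda>_. count_space (UNIV :: 's set)))"
    by simp
  have "{\<omega>. restrict \<omega> {0..<0} \<in> space (Pi\<^sub>M {0..<0::nat} (\<lambda>_. count_space (UNIV :: 's set)))} = UNIV"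
    by (auto simp: space_PiM)
  then show "emeasure (path_law p x) (space (path_law p x)) = 1"
    using emeasure_path_law_init[OF A] C.emeasure_space_1 unfolding sp space_path_law by simp
qed

lemma emeasure_path_law_cylinder_Suc:
  "emeasure (path_law p x) {\<omega>. \<forall>i<Suc n. \<omega> i = s i} =
     emeasure (path_law p x) {\<omega>. \<forall>i<n. \<omega> i = s i} * emeasure (chain_step p x n s) {s n}"
proof -
  let ?u = "\<lambda>_::nat. undefined :: 's"
  have fin: "finite {0..<m}" for m :: nat by simp
  have S: "{restrict s {0..<m}} \<in> sets (Pi\<^sub>M {0..<m} (\<lambda>_. count_space UNIV))" for m
  proof -
    have "(\<Pi>\<^sub>E i\<in>{0..<m}. {s i}) \<in> sets (Pi\<^sub>M {0..<m} (\<lambda>_. count_space UNIV))"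
      by (intro sets_PiM_I_finite) auto
    moreover have "(\<Pi>\<^sub>E i\<in>{0..<m}. {s i}) = {restrict s {0..<m}}"
      using PiE_singleton[of "restrict s {0..<m}" "{0..<m}"]
      by (simp cong: PiE_cong add: PiE_def Pi_def)
    ultimately show ?thesis by simp
  qed
  have cyl: "{\<omega>. \<forall>i<m. \<omega> i = s i} = {\<omega>. restrict \<omega> {0..<m} \<in> {restrict s {0..<m}}}" for m
    by (auto simp: fun_eq_iff restrict_def)
  have C: "emeasure (path_law p x) {\<omega>. \<forall>i<m. \<omega> i = s i} = emeasure (IT.C 0 m ?u) {restrict s {0..<m}}" for m
    unfolding cyl using emeasure_path_law_init[OF S] by simp
  have u: "?u \<in> space (Pi\<^sub>M {0..<0} (\<lambda>_. count_space UNIV))"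
    by (simp add: space_PiM)
  have spC: "space (IT.C 0 n ?u) = space (Pi\<^sub>M {0..<n} (\<lambda>_. count_space UNIV))"
    using IT.space_C[OF u, of n] by simp
  have stC: "sets (IT.C 0 n ?u) = sets (Pi\<^sub>M {0..<n} (\<lambda>_. count_space UNIV))"
    using IT.sets_C[OF u, of n] by simp
  have step: "emeasure (IT.eP n \<omega>) {restrict s {0..<Suc n}} =
      emeasure (chain_step p x n s) {s n} * indicator {restrict s {0..<n}} \<omega>"
    if w: "\<omega> \<in> space (Pi\<^sub>M {0..<n} (\<lambda>_. count_space UNIV))" for \<omega>
  proof -
    have e: "(fun_upd \<omega> n) -` {restrict s {0..<Suc n}} =
        (if \<omega> = restrict s {0..<n} then {s n} else {})"
    proof -
      have "fun_upd \<omega> n y = restrict s {0..<Suc n} \<longleftrightarrow> \<omega> = restrict s {0..<n} \<and> y = s n" for y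
        using w by (auto simp: space_PiM fun_eq_iff restrict_def PiE_iff extensional_def less_Suc_eq)
      then show ?thesis by auto
    qed
    have "chain_step p x n (restrict s {0..<n}) = chain_step p x n s"
      by (cases n) auto
    then show ?thesis
      using IT.emeasure_eP[OF w S[of "Suc n"]] by (auto simp: e)
  qed
  have eP: "IT.eP n \<in> measurable (IT.C 0 n ?u) (subprob_algebra (Pi\<^sub>M {0..<Suc n} (\<lambda>_. count_space UNIV)))"
    using IT.measurable_eP[of n] measurable_cong_sets[OF stC refl] by blast
  have "emeasure (IT.C 0 (Suc n) ?u) {restrict s {0..<Suc n}} =
      (\<integral>\<^sup>+ \<omega>. emeasure (IT.eP n \<omega>) {restrict s {0..<Suc n}} \<partial>IT.C 0 n ?u)"
    using emeasure_bind[OF _ eP S[of "Suc n"]] spC by simp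
  also have "\<dots> = (\<integral>\<^sup>+ \<omega>. emeasure (chain_step p x n s) {s n} * indicator {restrict s {0..<n}} \<omega> \<partial>IT.C 0 n ?u)"
    using step spC by (intro nn_integral_cong) auto
  also have "\<dots> = emeasure (chain_step p x n s) {s n} * emeasure (IT.C 0 n ?u) {restrict s {0..<n}}"
    using S[of n] stC by (intro nn_integral_cmult_indicator) auto
  finally show ?thesis
    by (simp only: C mult.commute)
qed

lemma markov_chain_path_law: "markov_chain (path_law p x) p x (\<lambda>n \<omega>. \<omega> n)"
proof -
  interpret prob_space "path_law p x"
    by (rule prob_space_path_law)
  have m: "(\<lambda>\<omega>. \<omega> n) \<in> measurable (path_law p x) (count_space UNIV)" for n :: nat
    unfolding measurable_cong_sets[OF sets_path_law refl]
    by (rule measurable_component_singleton) auto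
  have "emeasure (path_law p x) {\<omega>. \<omega> 0 = x} = 1"
    using emeasure_path_law_cylinder_Suc[of 0 "\<lambda>_. x"]
    by (simp add: emeasure_space_1[unfolded space_path_law] emeasure_pmf_single)
  then have "prob {\<omega> \<in> space (path_law p x). \<omega> 0 = x} = 1"
    by (simp add: measure_def space_path_law)
  then have i: "AE \<omega> in path_law p x. \<omega> 0 = x"
    by (auto simp: space_path_law dest: AE_prob_1)
  have "\<P>(\<omega> in path_law p x. \<omega> (Suc n) = y \<bar> \<forall>i\<le>n. \<omega> i = s i) = pmf (p (s n)) y"
    if pos: "\<P>(\<omega> in path_law p x. \<forall>i\<le>n. \<omega> i = s i) > 0" for n s y
  proof -
    let ?s = "s(Suc n := y)"
    have 1: "{\<omega>. \<omega> (Suc n) = y \<and> (\<forall>i\<le>n. \<omega> i = s i)} = {\<omega>. \<forall>i<Suc (Suc n). \<omega> i = ?s i}"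
      by (auto simp: less_Suc_eq_le le_Suc_eq)
    have 2: "{\<omega>. \<forall>i\<le>n. \<omega> i = s i} = {\<omega>. \<forall>i<Suc n. \<omega> i = ?s i}"
      by (auto simp: less_Suc_eq_le)
    have "prob {\<omega>. \<omega> (Suc n) = y \<and> (\<forall>i\<le>n. \<omega> i = s i)} = prob {\<omega>. \<forall>i\<le>n. \<omega> i = s i} * pmf (p (s n)) y"
      unfolding 1 2 measure_def emeasure_path_law_cylinder_Suc[of "Suc n"]
      by (simp add: enn2real_mult emeasure_pmf_single)
    then show ?thesis
      using pos by (simp add: cond_prob_def space_path_law)
  qed
  with m i show ?thesis
    unfolding markov_chain_def by blast
qed

end

end

theory Submission
  imports Defs
begin

text \<open>
  For two chains started at the same state, the number of pairs \<open>m, n < K\<close> with \<open>X m = Y n\<close>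
  has mean the truncated energy \<open>S\<close> (the sum of the squared truncated Green function), and by
  transitivity its second moment is at most \<open>4 S\<^sup>2\<close>. At such a pair, compare the futures of
  \<open>X\<close> and of \<open>Y\<close>, which are i.i.d. given the past: with probability at least a half, the first
  point of the current loop-erasure of \<open>X\<close> that is visited by \<open>Y\<close> comes no later than the
  one visited by \<open>X\<close>, and then it stays in the final loop-erasure. The second moment method
  hence gives a positive lower bound, uniform over the past of \<open>X\<close>, for the probability that
  \<open>Y\<close> hits the loop-erasure infinitely often.

  To pass from positive probability to probability one, let \<open>\<Phi>\<close> be an event that is invariant
  under shifting \<open>Y\<close> and that has probability at least \<open>2 c\<close>, whatever the past of \<open>X\<close>, when
  \<open>Y\<close> is restarted at the current state of \<open>X\<close>. Stop \<open>X\<close> on its first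
  visit, after time \<open>N\<close>, to the path of \<open>Y\<close> after time \<open>N\<close>. With
  probability at least \<open>c\<close> the future of \<open>X\<close> makes \<open>\<Phi>\<close> have conditional probability at
  least \<open>c\<close> for a fresh chain started there, and this state is on the path of \<open>Y\<close>. So \<open>\<Phi>\<close> has
  probability at least \<open>c\<^sup>2\<close> on every event of the past with intersections after \<open>N\<close>, and
  therefore holds almost surely if there are infinitely many intersections. With \<open>\<Phi>\<close> the absence of
  infinitely many intersections this is a zero-one law for intersections; with \<open>\<Phi>\<close> the event that
  \<open>Y\<close> hits the loop-erasure infinitely often it yields the theorem.
\<close>

section \<open>Path space and the Markov property\<close>

declare sets_path_law [measurable_cong]

lemma measurable_coordinate:
  "f \<in> measurable M path_space \<Longrightarrow> (\<lambda>\<omega>. f \<omega> n) \<in> measurable M (count_space UNIV)"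
  by (rule measurable_compose[OF _ measurable_component_singleton]) auto

lemma measurable_path_spaceI:
  "(\<And>n. (\<lambda>\<omega>. f \<omega> n) \<in> measurable M (count_space UNIV)) \<Longrightarrow> f \<in> measurable M path_space"
  by (rule measurable_PiM_single') (auto simp: space_PiM)

lemma emeasure_path_law_UNIV [simp]: "emeasure (path_law p x) UNIV = 1"
  using prob_space.emeasure_space_1[OF prob_space_path_law[of p x]] by (simp add: space_path_law)

text \<open>The product form of the one-step rule needs no conditioning on null events, and at
  \<open>n = 0\<close> it encodes the initial state. By induction it fixes the mass of every
  cylinder, and the cylinders generate the sigma-algebra.\<close>

theorem path_law_unique:
  fixes p :: "'s :: countable \<Rightarrow> 's pmf"
  assumes Q: "prob_space Q" and sets [measurable_cong]: "sets Q = sets path_space"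
    and cyl: "\<And>n s. emeasure Q {\<omega>. \<forall>i<Suc n. \<omega> i = s i} =
      emeasure Q {\<omega>. \<forall>i<n. \<omega> i = s i} * emeasure (chain_step p x n s) {s n}"
  shows "Q = path_law p x"
proof -
  interpret Q: prob_space Q by (rule Q)
  have spQ: "space Q = UNIV"
    using sets_eq_imp_space_eq[OF sets] by (simp add: space_PiM)
  have eq: "emeasure Q {\<omega>. \<forall>i<n. \<omega> i = s i} = emeasure (path_law p x) {\<omega>. \<forall>i<n. \<omega> i = s i}"
    for n s
  proof (induction n)
    case 0
    show ?case using Q.emeasure_space_1 by (simp add: spQ)
  next
    case (Suc n)
    show ?case unfolding emeasure_path_law_cylinder_Suc cyl Suc.IH ..
  qed
  \<comment> \<open>Two cylinders are nested or disjoint, so adding the empty set makes the family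
    stable under intersection.\<close>
  define C :: "(nat \<Rightarrow> 's) set set" where "C = insert {} {{\<omega>. \<forall>i<n. \<omega> i = s i} | n s. True}"
  have fin: "{\<omega>. \<forall>i<n. \<omega> i = s i} \<in> C" for n s
    by (auto simp: C_def)
  have Int: "Int_stable C"
  proof (rule Int_stableI)
    fix a b assume "a \<in> C" "b \<in> C"
    have *: "{\<omega>. \<forall>i<n. \<omega> i = s i} \<inter> {\<omega>. \<forall>i<m. \<omega> i = t i} \<in> C" if "n \<le> m" for n m :: nat and s t :: "nat \<Rightarrow> 's"
    proof (cases "\<forall>i<n. s i = t i")
      case True
      then have "{\<omega>. \<forall>i<n. \<omega> i = s i} \<inter> {\<omega>. \<forall>i<m. \<omega> i = t i} = {\<omega>. \<forall>i<m. \<omega> i = t i}"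
        using that by auto
      then show ?thesis using fin by simp
    next
      case False
      then have "{\<omega>. \<forall>i<n. \<omega> i = s i} \<inter> {\<omega>. \<forall>i<m. \<omega> i = t i} = {}"
        using that by force
      then show ?thesis by (simp add: C_def)
    qed
    show "a \<inter> b \<in> C"
    proof (cases "a = {} \<or> b = {}")
      case True then show ?thesis by (auto simp: C_def)
    next
      case False
      with \<open>a \<in> C\<close> \<open>b \<in> C\<close> obtain n s m t where
        "a = {\<omega>. \<forall>i<n. \<omega> i = s i}" "b = {\<omega>. \<forall>i<m. \<omega> i = t i}"
        by (auto simp: C_def)
      then show ?thesis
        using *[of n m s t] *[of m n t s] linear[of n m] by (metis Int_commute)
    qed
  qed
  have CP: "C \<subseteq> Pow UNIV" by simp
  have Csets: "C \<subseteq> sets path_space"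
  proof
    fix a assume "a \<in> C"
    moreover have "{\<omega>. \<forall>i<n. \<omega> i = s i} \<in> sets path_space" for n and s :: "nat \<Rightarrow> 's"
    proof -
      have "{\<omega> \<in> space path_space. \<forall>i<n. \<omega> i = s i} \<in> sets path_space" by measurable
      then show ?thesis by (simp add: space_PiM)
    qed
    ultimately show "a \<in> sets path_space" by (auto simp: C_def)
  qed
  let ?S = "sigma UNIV C"
  have coord: "(\<lambda>\<omega>. \<omega> n) \<in> measurable ?S (count_space UNIV)" for n
    unfolding measurable_count_space_eq2_countable
  proof (intro conjI ballI)
    fix y :: 's
    \<comment> \<open>Countability of the state space enters here: the first \<open>n\<close> values
      range over countably many lists.\<close>
    have "(\<lambda>\<omega>. \<omega> n) -` {y} \<inter> space ?S =
      (\<Union>t\<in>{t. length t = n}. {\<omega>. \<forall>i<Suc n. \<omega> i = (t @ [y]) ! i})"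
    proof (rule Set.set_eqI, rule iffI)
      fix \<omega> assume "\<omega> \<in> (\<lambda>\<omega>. \<omega> n) -` {y} \<inter> space ?S"
      then have "\<forall>i<Suc n. \<omega> i = (map \<omega> [0..<n] @ [y]) ! i"
        by (simp add: nth_append less_Suc_eq)
      then show "\<omega> \<in> (\<Union>t\<in>{t. length t = n}. {\<omega>. \<forall>i<Suc n. \<omega> i = (t @ [y]) ! i})"
        by (intro UN_I[of "map \<omega> [0..<n]"]) simp_all
    next
      fix \<omega> assume "\<omega> \<in> (\<Union>t\<in>{t. length t = n}. {\<omega>. \<forall>i<Suc n. \<omega> i = (t @ [y]) ! i})"
      then obtain t where "length t = n" "\<omega> n = (t @ [y]) ! n" by blast
      then show "\<omega> \<in> (\<lambda>\<omega>. \<omega> n) -` {y} \<inter> space ?S" by (simp add: nth_append)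
    qed
    moreover have "\<dots> \<in> sets ?S"
      using fin by (intro sets.countable_UN') auto
    ultimately show "(\<lambda>\<omega>. \<omega> n) -` {y} \<inter> space ?S \<in> sets ?S" by simp
  qed simp
  have id: "(\<lambda>\<omega>. \<omega>) \<in> measurable ?S path_space"
    using coord by (rule measurable_path_spaceI)
  have "A \<in> sets ?S" if "A \<in> sets path_space" for A
    using measurable_sets[OF id that] by (simp only: vimage_ident space_measure_of_conv Int_UNIV_right)
  moreover have "sets ?S \<subseteq> sets path_space"
    using sets.sigma_sets_subset[OF Csets] by (simp add: space_PiM)
  ultimately have "sets path_space = sets ?S" by blast
  then have gen: "sets path_space = sigma_sets UNIV C" by simp
  show ?thesis
  proof (rule measure_eqI_generator_eq[OF Int CP, where A="\<lambda>_. UNIV"])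
    show "emeasure Q X = emeasure (path_law p x) X" if "X \<in> C" for X
      using that eq by (auto simp: C_def)
    show "sets Q = sigma_sets UNIV C" using sets gen by simp
    show "sets (path_law p x) = sigma_sets UNIV C" using gen by (simp add: sets_path_law)
    show "range (\<lambda>_. UNIV) \<subseteq> C" using fin[of 0] by simp
    show "emeasure Q UNIV \<noteq> \<infinity>" using Q.emeasure_space_1 spQ by simp
  qed simp
qed

text \<open>Coordinate \<open>n\<close> comes from \<omega>' and not from \<omega>. The two agree
  almost surely once \<omega>' is a chain started at \<open>\<omega> n\<close>.\<close>

definition glue :: "nat \<Rightarrow> (nat \<Rightarrow> 's) \<Rightarrow> (nat \<Rightarrow> 's) \<Rightarrow> nat \<Rightarrow> 's" where
  "glue n \<omega> \<omega>' = (\<lambda>i. if i < n then \<omega> i else \<omega>' (i - n))"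

lemma glue_simps [simp]:
  "i < n \<Longrightarrow> glue n \<omega> \<omega>' i = \<omega> i"
  "glue n \<omega> \<omega>' (n + i) = \<omega>' i"
  by (simp_all add: glue_def)

lemma measurable_glue [measurable (raw)]:
  assumes [measurable]: "f \<in> measurable M path_space" "g \<in> measurable M path_space"
  shows "(\<lambda>x. glue n (f x) (g x)) \<in> measurable M path_space"
proof (rule measurable_path_spaceI)
  fix i
  show "(\<lambda>x. glue n (f x) (g x) i) \<in> measurable M (count_space UNIV)"
    using measurable_coordinate[OF assms(1)] measurable_coordinate[OF assms(2)]
    by (cases "i < n") (simp_all add: glue_def)
qed

lemma measurable_glue_right [measurable]: "glue n \<omega> \<in> measurable path_space path_space"
  by (rule measurable_glue[OF measurable_const measurable_ident_sets[OF refl]]) (simp add: space_PiM)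

lemma Collect_in_sets_path_space:
  "Measurable.pred path_space E \<Longrightarrow> {\<omega>. E \<omega>} \<in> sets path_space"
  by (drule predE) (simp add: space_PiM)

lemma path_law_kernel [measurable (raw)]:
  assumes [measurable]: "f \<in> measurable M (count_space UNIV)"
  shows "(\<lambda>x. path_law p (f x)) \<in> measurable M (subprob_algebra path_space)"
proof -
  have "path_law p \<in> measurable (count_space UNIV) (subprob_algebra path_space)"
    by (auto simp: space_subprob_algebra sets_path_law intro!: prob_space_imp_subprob_space prob_space_path_law)
  then show ?thesis
    by (rule measurable_compose[OF assms])
qed

text \<open>This is the Markov property at time \<open>n\<close>, stated as invariance under
  resampling the future from the current state. The resampled law is shown to satisfy the recursion
  of \<open>path_law_unique\<close>.\<close>

lemma path_law_eq_bind:
  "path_law p x = path_law p x \<bind> (\<lambda>\<omega>. distr (path_law p (\<omega> n)) path_space (glue n \<omega>))"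
    (is "_ = ?Q")
proof -
  have k [measurable]: "(\<lambda>\<omega>. distr (path_law p (\<omega> n)) path_space (glue n \<omega>))
      \<in> measurable (path_law p x) (subprob_algebra path_space)"
    by (rule measurable_distr2) measurable
  have ne: "space (path_law p x) \<noteq> {}" by (simp add: space_path_law)
  have em: "emeasure ?Q E = (\<integral>\<^sup>+ \<omega>. emeasure (path_law p (\<omega> n)) {\<omega>'. glue n \<omega> \<omega>' \<in> E} \<partial>path_law p x)"
    if E: "E \<in> sets path_space" for E
    unfolding emeasure_bind[OF ne k E]
    by (intro nn_integral_cong, subst emeasure_distr[OF _ E])
      (auto simp: space_path_law vimage_def measurable_cong_sets[OF sets_path_law refl] measurable_glue_right)
  have cylm: "{\<omega>. \<forall>i<m. \<omega> i = s i} \<in> sets path_space" for m and s :: "nat \<Rightarrow> 'a"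
  proof -
    have "{\<omega> \<in> space path_space. \<forall>i<m. \<omega> i = s i} \<in> sets path_space" by measurable
    then show ?thesis by (simp add: space_PiM)
  qed
  let ?P = "path_law p x"
  have small: "emeasure ?Q {\<omega>. \<forall>i<m. \<omega> i = s i} = emeasure ?P {\<omega>. \<forall>i<m. \<omega> i = s i}" if "m \<le> n" for m s
  proof -
    have "emeasure ?Q {\<omega>. \<forall>i<m. \<omega> i = s i} = (\<integral>\<^sup>+ \<omega>. indicator {\<omega>. \<forall>i<m. \<omega> i = s i} \<omega> \<partial>?P)"
      unfolding em[OF cylm] using that
      by (intro nn_integral_cong) (auto simp: glue_def split: split_indicator)
    then show ?thesis using cylm by (simp add: sets_path_law)
  qed
  have large: "emeasure ?Q {\<omega>. \<forall>i<n + m. \<omega> i = s i} = (\<integral>\<^sup>+ \<omega>. indicator {\<omega>. \<forall>i<n. \<omega> i = s i} \<omega> *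
     emeasure (path_law p (\<omega> n)) {\<omega>'. \<forall>i<m. \<omega>' i = s (n + i)} \<partial>?P)" for m s
    unfolding em[OF cylm]
  proof (intro nn_integral_cong)
    fix \<omega>
    have "(\<forall>i<n + m. glue n \<omega> \<omega>' i = s i) \<longleftrightarrow> (\<forall>i<n. \<omega> i = s i) \<and> (\<forall>i<m. \<omega>' i = s (n + i))" for \<omega>'
    proof safe
      fix i assume *: "\<forall>i<n. \<omega> i = s i" "\<forall>i<m. \<omega>' i = s (n + i)" "i < n + m"
      then show "glue n \<omega> \<omega>' i = s i"
        using *(2)[rule_format, of "i - n"] by (auto simp: glue_def)
    next
      fix i assume *: "\<forall>i<n + m. glue n \<omega> \<omega>' i = s i"
      show "i < n \<Longrightarrow> \<omega> i = s i" using *[rule_format, of i] by simp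
      show "i < m \<Longrightarrow> \<omega>' i = s (n + i)" using *[rule_format, of "n + i"] by simp
    qed
    then have "{\<omega>'. glue n \<omega> \<omega>' \<in> {\<omega>. \<forall>i<n + m. \<omega> i = s i}} =
      (if \<forall>i<n. \<omega> i = s i then {\<omega>'. \<forall>i<m. \<omega>' i = s (n + i)} else {})" by auto
    then show "emeasure (path_law p (\<omega> n)) {\<omega>'. glue n \<omega> \<omega>' \<in> {\<omega>. \<forall>i<n + m. \<omega> i = s i}} =
      indicator {\<omega>. \<forall>i<n. \<omega> i = s i} \<omega> * emeasure (path_law p (\<omega> n)) {\<omega>'. \<forall>i<m. \<omega>' i = s (n + i)}"
      by (simp split: split_indicator)
  qed
  have "?Q = path_law p x"
  proof (rule path_law_unique)
    show "prob_space ?Q"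
      by (intro prob_space.prob_space_bind[OF prob_space_path_law _ k])
        (auto intro!: AE_I2 prob_space.prob_space_distr prob_space_path_law)
    show "sets ?Q = sets path_space"
      by (rule sets_bind[OF _ ne]) simp
    fix m s
    show "emeasure ?Q {\<omega>. \<forall>i<Suc m. \<omega> i = s i} =
      emeasure ?Q {\<omega>. \<forall>i<m. \<omega> i = s i} * emeasure (chain_step p x m s) {s m}"
    proof (cases "m < n")
      case True
      then show ?thesis
        using small[of m s] small[of "Suc m" s] emeasure_path_law_cylinder_Suc[of p x m s] by simp
    next
      case False
      then obtain d where m: "m = n + d" by (metis le_Suc_ex not_less)
      show ?thesis
      proof (cases d)
        case 0
        \<comment> \<open>Coordinate \<open>n\<close> is the start of the new piece, hence equal to
          \<open>\<omega> n\<close> almost surely, so the cylinder of length \<open>n + 1\<close>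
          keeps its mass.\<close>
        have "emeasure ?Q {\<omega>. \<forall>i<n + 1. \<omega> i = s i} =
          (\<integral>\<^sup>+ \<omega>. indicator {\<omega>. \<forall>i<Suc n. \<omega> i = s i} \<omega> \<partial>?P)"
          unfolding large using emeasure_path_law_cylinder_Suc[of p _ 0 "\<lambda>i. s (n + i)"]
          by (intro nn_integral_cong) (auto split: split_indicator simp: less_Suc_eq emeasure_pmf_single)
        also have "\<dots> = emeasure ?P {\<omega>. \<forall>i<Suc n. \<omega> i = s i}"
          using cylm[of "Suc n"] by (simp add: sets_path_law)
        finally show ?thesis
          using small[of n s] emeasure_path_law_cylinder_Suc[of p x n s] by (simp add: m 0)
      next
        case (Suc e)
        \<comment> \<open>Past time \<open>n\<close> the step law depends on \<open>s\<close> alone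
          and not on the state from which the path is resampled, so this factor leaves the
          integral.\<close>
        have st: "emeasure (path_law p y) {\<omega>'. \<forall>i<Suc d. \<omega>' i = s (n + i)} =
          emeasure (path_law p y) {\<omega>'. \<forall>i<d. \<omega>' i = s (n + i)} * emeasure (chain_step p x m s) {s m}" for y
          using emeasure_path_law_cylinder_Suc[of p y d "\<lambda>i. s (n + i)"] by (simp add: m Suc)
        have [measurable]: "(\<lambda>\<omega>. emeasure (path_law p (\<omega> n)) {\<omega>'. \<forall>i<d. \<omega>' i = s (n + i)}) \<in> borel_measurable ?P"
          by (rule measurable_compose[OF path_law_kernel measurable_emeasure_subprob_algebra[OF cylm]])
            measurable
        have [measurable]: "{\<omega>. \<forall>i<n. \<omega> i = s i} \<in> sets ?P" using cylm by (simp add: sets_path_law)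
        have "emeasure ?Q {\<omega>. \<forall>i<n + Suc d. \<omega> i = s i} =
          emeasure ?Q {\<omega>. \<forall>i<n + d. \<omega> i = s i} * emeasure (chain_step p x m s) {s m}"
          unfolding large st by (subst nn_integral_multc[symmetric]) (auto simp: mult.assoc)
        then show ?thesis by (simp add: m)
      qed
    qed
  qed
  then show ?thesis by simp
qed

lemma nn_integral_path_law_split:
  assumes [measurable]: "f \<in> borel_measurable path_space"
  shows "(\<integral>\<^sup>+ \<omega>. f \<omega> \<partial>path_law p x) = (\<integral>\<^sup>+ \<omega>. \<integral>\<^sup>+ \<omega>'. f (glue n \<omega> \<omega>') \<partial>path_law p (\<omega> n) \<partial>path_law p x)"
proof -
  have [measurable]: "(\<lambda>\<omega>. distr (path_law p (\<omega> n)) path_space (glue n \<omega>))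
      \<in> measurable (path_law p x) (subprob_algebra path_space)"
    by (rule measurable_distr2) measurable
  show ?thesis
    by (subst path_law_eq_bind[of p x n], subst nn_integral_bind[of _ path_space])
      (auto intro!: nn_integral_cong nn_integral_distr
        simp: measurable_cong_sets[OF sets_path_law refl] measurable_glue_right)
qed

lemma emeasure_path_law_split:
  assumes [measurable]: "Measurable.pred path_space E"
  shows "emeasure (path_law p x) {\<omega>. E \<omega>} =
    (\<integral>\<^sup>+ \<omega>. emeasure (path_law p (\<omega> n)) {\<omega>'. E (glue n \<omega> \<omega>')} \<partial>path_law p x)"
proof -
  note S = Collect_in_sets_path_space
  have "emeasure (path_law p x) {\<omega>. E \<omega>} = (\<integral>\<^sup>+ \<omega>. indicator {\<omega>. E \<omega>} \<omega> \<partial>path_law p x)"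
    by (simp add: S sets_path_law)
  also have "\<dots> = (\<integral>\<^sup>+ \<omega>. \<integral>\<^sup>+ \<omega>'. indicator {\<omega>. E \<omega>} (glue n \<omega> \<omega>') \<partial>path_law p (\<omega> n) \<partial>path_law p x)"
    by (rule nn_integral_path_law_split) (simp add: S)
  also have "\<dots> = (\<integral>\<^sup>+ \<omega>. \<integral>\<^sup>+ \<omega>'. indicator {\<omega>'. E (glue n \<omega> \<omega>')} \<omega>' \<partial>path_law p (\<omega> n) \<partial>path_law p x)"
    by (simp add: indicator_def)
  also have "\<dots> = (\<integral>\<^sup>+ \<omega>. emeasure (path_law p (\<omega> n)) {\<omega>'. E (glue n \<omega> \<omega>')} \<partial>path_law p x)"
  proof (intro nn_integral_cong nn_integral_indicator)
    fix \<omega>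
    have "Measurable.pred path_space (\<lambda>\<omega>'. E (glue n \<omega> \<omega>'))" by measurable
    then show "{\<omega>'. E (glue n \<omega> \<omega>')} \<in> sets (path_law p (\<omega> n))"
      by (simp add: S sets_path_law)
  qed
  finally show ?thesis .
qed

lemma measurable_emeasure_path_law:
  assumes [measurable]: "f \<in> measurable M (count_space UNIV)"
    and E: "Measurable.pred (M \<Otimes>\<^sub>M path_space) (\<lambda>z. E (fst z) (snd z))"
  shows "(\<lambda>x. emeasure (path_law p (f x)) {\<omega>. E x \<omega>}) \<in> borel_measurable M"
proof -
  have "(SIGMA x:space M. {\<omega>. E x \<omega>}) = {z \<in> space (M \<Otimes>\<^sub>M path_space). E (fst z) (snd z)}"
    by (auto simp: space_pair_measure space_PiM)
  with E have "(SIGMA x:space M. {\<omega>. E x \<omega>}) \<in> sets (M \<Otimes>\<^sub>M path_space)"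
    by (simp add: predE)
  then show ?thesis
    by (rule emeasure_measurable_subprob_algebra2) measurable
qed

lemma emeasure_path_law_mono:
  assumes "Measurable.pred path_space F" and "\<And>\<omega>. E \<omega> \<Longrightarrow> F \<omega>"
  shows "emeasure (path_law p x) {\<omega>. E \<omega>} \<le> emeasure (path_law p x) {\<omega>. F \<omega>}"
  using assms Collect_in_sets_path_space by (intro emeasure_mono) (auto simp: sets_path_law)

section \<open>Adapted events and decomposition at the first entrance\<close>

definition adapted :: "nat \<Rightarrow> ((nat \<Rightarrow> 's) \<Rightarrow> bool) \<Rightarrow> bool" where
  "adapted n E \<longleftrightarrow> (\<forall>\<omega> \<omega>'. (\<forall>i\<le>n. \<omega> i = \<omega>' i) \<longrightarrow> E \<omega> = E \<omega>')"

text \<open>Decomposing at the first \<open>m\<close> with \<open>R m\<close> replaces the strong Markov property.\<close>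
lemma first_entrance_bound:
  assumes R [measurable]: "\<And>m. Measurable.pred path_space (R m)"
    and E [measurable]: "Measurable.pred path_space E"
    and adapted: "\<And>m. adapted m (R m)"
    and bound: "\<And>m \<omega>. R m \<omega> \<Longrightarrow> 
      c \<le> emeasure (path_law p (\<omega> m)) {\<omega>'. \<omega>' 0 = \<omega> m \<longrightarrow> E (glue m \<omega> \<omega>')}"
  shows "c * emeasure (path_law p x) {\<omega>. \<exists>m. R m \<omega>} \<le> emeasure (path_law p x) {\<omega>. E \<omega>}"
proof -
  let ?P = "path_law p x"
  define F where "F m \<omega> \<longleftrightarrow> R m \<omega> \<and> (\<forall>i<m. \<not> R i \<omega>)" for m \<omega>
  have F [measurable]: "Measurable.pred path_space (F m)" for m
    unfolding F_def by measurable
  have first: "(\<exists>m. R m \<omega>) \<longleftrightarrow> (\<exists>m. F m \<omega>)" for \<omega>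
    unfolding F_def by (rule exists_least_iff)
  have disj: "F m \<omega> \<Longrightarrow> F n \<omega> \<Longrightarrow> m = n" for m n \<omega>
    unfolding F_def by (metis linorder_neqE_nat)
  have S: "{\<omega>. F m \<omega> \<and> E \<omega>} \<in> sets ?P" "{\<omega>. F m \<omega>} \<in> sets ?P" for m
    using Collect_in_sets_path_space[of "\<lambda>\<omega>. F m \<omega> \<and> E \<omega>"] Collect_in_sets_path_space[OF F, of m]
    by (simp_all add: sets_path_law)
  have step: "c * emeasure ?P {\<omega>. F m \<omega>} \<le> emeasure ?P {\<omega>. F m \<omega> \<and> E \<omega>}" for m
  proof -
    \<comment> \<open>Gluing at \<open>m\<close> leaves the coordinates up to \<open>m\<close> alone
      when the new piece starts at \<open>\<omega> m\<close>, so whether \<open>m\<close> is the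
      first entrance is already decided.\<close>
    have g: "F m (glue m \<omega> \<omega>') \<longleftrightarrow> F m \<omega>" if "\<omega>' 0 = \<omega> m" for \<omega> \<omega>'
    proof -
      have eq: "glue m \<omega> \<omega>' j = \<omega> j" if "j \<le> m" for j
        using that \<open>\<omega>' 0 = \<omega> m\<close> by (cases "j = m") (simp_all add: glue_def)
      have "R i (glue m \<omega> \<omega>') = R i \<omega>" if "i \<le> m" for i
        using adapted[of i] eq that unfolding adapted_def by (meson order_trans)
      then show ?thesis by (auto simp: F_def)
    qed
    have "c * emeasure ?P {\<omega>. F m \<omega>} = (\<integral>\<^sup>+ \<omega>. c * indicator {\<omega>. F m \<omega>} \<omega> \<partial>?P)"
      using S by (simp add: nn_integral_cmult_indicator)
    also have "\<dots> \<le> (\<integral>\<^sup>+ \<omega>. emeasure (path_law p (\<omega> m)) {\<omega>'. F m (glue m \<omega> \<omega>') \<and> E (glue m \<omega> \<omega>')} \<partial>?P)"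
    proof (intro nn_integral_mono)
      fix \<omega>
      show "c * indicator {\<omega>. F m \<omega>} \<omega> \<le>
        emeasure (path_law p (\<omega> m)) {\<omega>'. F m (glue m \<omega> \<omega>') \<and> E (glue m \<omega> \<omega>')}"
      proof (cases "F m \<omega>")
        case True
        \<comment> \<open>The premise inside the event in \<open>bound\<close> holds almost surely
          for the restarted chain.\<close>
        have s: "AE \<omega>' in path_law p (\<omega> m). \<omega>' 0 = \<omega> m"
          using markov_chain_path_law[of p "\<omega> m"] by (simp add: markov_chain_def)
        have "c \<le> emeasure (path_law p (\<omega> m)) {\<omega>'. \<omega>' 0 = \<omega> m \<longrightarrow> E (glue m \<omega> \<omega>')}"
          using True bound by (simp add: F_def)
        also have "\<dots> = emeasure (path_law p (\<omega> m)) {\<omega>'. F m (glue m \<omega> \<omega>') \<and> E (glue m \<omega> \<omega>')}"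
        proof (intro emeasure_eq_AE)
          show "AE \<omega>' in path_law p (\<omega> m). (\<omega>' \<in> {\<omega>'. \<omega>' 0 = \<omega> m \<longrightarrow> E (glue m \<omega> \<omega>')}) =
              (\<omega>' \<in> {\<omega>'. F m (glue m \<omega> \<omega>') \<and> E (glue m \<omega> \<omega>')})"
            using s by eventually_elim (use True g in auto)
        next
          have "Measurable.pred path_space (\<lambda>\<omega>'. \<omega>' 0 = \<omega> m \<longrightarrow> E (glue m \<omega> \<omega>'))"
            "Measurable.pred path_space (\<lambda>\<omega>'. F m (glue m \<omega> \<omega>') \<and> E (glue m \<omega> \<omega>'))" by measurable
          then show "{\<omega>'. \<omega>' 0 = \<omega> m \<longrightarrow> E (glue m \<omega> \<omega>')} \<in> sets (path_law p (\<omega> m))"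
            "{\<omega>'. F m (glue m \<omega> \<omega>') \<and> E (glue m \<omega> \<omega>')} \<in> sets (path_law p (\<omega> m))"
            by (simp_all add: Collect_in_sets_path_space sets_path_law)
        qed
        finally show ?thesis using True by simp
      qed simp
    qed
    also have "\<dots> = emeasure ?P {\<omega>. F m \<omega> \<and> E \<omega>}"
      by (rule emeasure_path_law_split[symmetric]) measurable
    finally show ?thesis .
  qed
  have "c * emeasure ?P {\<omega>. \<exists>m. R m \<omega>} = c * emeasure ?P (\<Union>m. {\<omega>. F m \<omega>})"
    by (simp add: first Collect_ex_eq)
  also have "\<dots> = c * (\<Sum>m. emeasure ?P {\<omega>. F m \<omega>})"
    using S(2) disj by (subst suminf_emeasure) (auto simp: disjoint_family_on_def)
  also have "\<dots> = (\<Sum>m. c * emeasure ?P {\<omega>. F m \<omega>})"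
    by simp
  also have "\<dots> \<le> (\<Sum>m. emeasure ?P {\<omega>. F m \<omega> \<and> E \<omega>})"
    by (intro suminf_le step) auto
  also have "\<dots> = emeasure ?P (\<Union>m. {\<omega>. F m \<omega> \<and> E \<omega>})"
    using S(1) disj by (intro suminf_emeasure) (auto simp: disjoint_family_on_def)
  also have "\<dots> \<le> emeasure ?P {\<omega>. E \<omega>}"
    using E by (intro emeasure_mono) (auto simp: sets_path_law Collect_in_sets_path_space)
  finally show ?thesis .
qed

section \<open>Transience and uniqueness in law\<close>

lemma AE_path_law_start: "AE \<omega> in path_law p x. \<omega> 0 = x"
  using markov_chain_path_law[of p x] by (simp add: markov_chain_def)

definition path_shift :: "nat \<Rightarrow> (nat \<Rightarrow> 's) \<Rightarrow> nat \<Rightarrow> 's" where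
  "path_shift n \<omega> = (\<lambda>i. \<omega> (n + i))"

lemma path_shift_apply [simp]: "path_shift n \<omega> i = \<omega> (n + i)"
  by (simp add: path_shift_def)

lemma path_shift_glue [simp]: "path_shift n (glue n \<omega> \<omega>') = \<omega>'"
  by (simp add: path_shift_def)

lemma measurable_shift [measurable]: "path_shift n \<in> measurable path_space path_space"
  unfolding path_shift_def by (rule measurable_path_spaceI) measurable

lemma emeasure_path_law_shift:
  assumes [measurable]: "Measurable.pred path_space R" "Measurable.pred path_space E"
    and R: "adapted n R"
  shows "emeasure (path_law p x) {\<omega>. R \<omega> \<and> E (path_shift n \<omega>)} =
    (\<integral>\<^sup>+ \<omega>. indicator {\<omega>. R \<omega>} \<omega> * emeasure (path_law p (\<omega> n)) {\<omega>'. E \<omega>'} \<partial>path_law p x)"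
proof -
  have "emeasure (path_law p x) {\<omega>. R \<omega> \<and> E (path_shift n \<omega>)} =
    (\<integral>\<^sup>+ \<omega>. emeasure (path_law p (\<omega> n)) {\<omega>'. R (glue n \<omega> \<omega>') \<and> E (path_shift n (glue n \<omega> \<omega>'))} \<partial>path_law p x)"
    by (rule emeasure_path_law_split) measurable
  also have "\<dots> = (\<integral>\<^sup>+ \<omega>. indicator {\<omega>. R \<omega>} \<omega> * emeasure (path_law p (\<omega> n)) {\<omega>'. E \<omega>'} \<partial>path_law p x)"
  proof (intro nn_integral_cong)
    fix \<omega>
    have "emeasure (path_law p (\<omega> n)) {\<omega>'. R (glue n \<omega> \<omega>') \<and> E (path_shift n (glue n \<omega> \<omega>'))} =
      emeasure (path_law p (\<omega> n)) {\<omega>'. R \<omega> \<and> E \<omega>'}"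
    proof (intro emeasure_eq_AE)
      show "AE \<omega>' in path_law p (\<omega> n). \<omega>' \<in> {\<omega>'. R (glue n \<omega> \<omega>') \<and> E (path_shift n (glue n \<omega> \<omega>'))} \<longleftrightarrow>
        \<omega>' \<in> {\<omega>'. R \<omega> \<and> E \<omega>'}"
        using AE_path_law_start
      proof eventually_elim
        case (elim \<omega>')
        have "glue n \<omega> \<omega>' j = \<omega> j" if "j \<le> n" for j
          using that elim by (cases "j = n") (simp_all add: glue_def)
        then have "R (glue n \<omega> \<omega>') = R \<omega>"
          using R unfolding adapted_def by meson
        then show ?case by simp
      qed
    next
      have "Measurable.pred path_space (\<lambda>\<omega>'. R (glue n \<omega> \<omega>') \<and> E (path_shift n (glue n \<omega> \<omega>')))"
        by measurable
      then show "{\<omega>'. R (glue n \<omega> \<omega>') \<and> E (path_shift n (glue n \<omega> \<omega>'))} \<in> sets (path_law p (\<omega> n))"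
        by (simp add: sets_path_law Collect_in_sets_path_space)
      have "Measurable.pred path_space (\<lambda>\<omega>'. R \<omega> \<and> E \<omega>')"
        by measurable
      then show "{\<omega>'. R \<omega> \<and> E \<omega>'} \<in> sets (path_law p (\<omega> n))"
        by (simp add: sets_path_law Collect_in_sets_path_space)
    qed
    then show "emeasure (path_law p (\<omega> n)) {\<omega>'. R (glue n \<omega> \<omega>') \<and> E (path_shift n (glue n \<omega> \<omega>'))} =
      indicator {\<omega>. R \<omega>} \<omega> * emeasure (path_law p (\<omega> n)) {\<omega>'. E \<omega>'}"
      by (simp split: split_indicator)
  qed
  finally show ?thesis .
qed

lemma emeasure_path_law_shift_at:
  assumes E [measurable]: "Measurable.pred path_space E"
  shows "emeasure (path_law p x) {\<omega>. \<omega> n = y \<and> E (path_shift n \<omega>)} =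
    emeasure (path_law p x) {\<omega>. \<omega> n = y} * emeasure (path_law p y) {\<omega>. E \<omega>}"
proof -
  have S: "{\<omega>. \<omega> n = y} \<in> sets (path_law p x)"
    by (simp add: sets_path_law Collect_in_sets_path_space)
  have "emeasure (path_law p x) {\<omega>. \<omega> n = y \<and> E (path_shift n \<omega>)} =
    (\<integral>\<^sup>+ \<omega>. indicator {\<omega>. \<omega> n = y} \<omega> * emeasure (path_law p (\<omega> n)) {\<omega>'. E \<omega>'} \<partial>path_law p x)"
    by (rule emeasure_path_law_shift) (auto simp: adapted_def)
  also have "\<dots> = (\<integral>\<^sup>+ \<omega>. emeasure (path_law p y) {\<omega>'. E \<omega>'} * indicator {\<omega>. \<omega> n = y} \<omega> \<partial>path_law p x)"
    by (intro nn_integral_cong) (simp split: split_indicator)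
  also have "\<dots> = emeasure (path_law p y) {\<omega>'. E \<omega>'} * emeasure (path_law p x) {\<omega>. \<omega> n = y}"
    by (rule nn_integral_cmult_indicator[OF S])
  finally show ?thesis by (simp add: mult.commute)
qed

text \<open>The last visits to \<open>y\<close> at different times are disjoint events, so the expected number of
  visits is at most the reciprocal of the escape probability.\<close>
lemma transient_finitely_many_visits:
  fixes p :: "'s :: countable \<Rightarrow> 's pmf"
  assumes "transient_state p y"
  shows "AE \<omega> in path_law p x. \<exists>k. \<forall>n\<ge>k. \<omega> n \<noteq> y"
proof -
  interpret x: prob_space "path_law p x" by (rule prob_space_path_law)
  interpret y: prob_space "path_law p y" by (rule prob_space_path_law)
  define E where "E \<omega> \<longleftrightarrow> (\<forall>i>0. \<omega> i \<noteq> y)" for \<omega> :: "nat \<Rightarrow> 's"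
  have E [measurable]: "Measurable.pred path_space E" unfolding E_def by measurable
  define r where "r = emeasure (path_law p y) {\<omega>. E \<omega>}"
  have "{\<omega>. \<not> E \<omega>} \<in> sets (path_law p y)"
    by (simp add: sets_path_law Collect_in_sets_path_space)
  then have "y.prob (space (path_law p y) - {\<omega>. \<not> E \<omega>}) = 1 - y.prob {\<omega>. \<not> E \<omega>}"
    by (rule y.prob_compl)
  moreover have "space (path_law p y) - {\<omega>. \<not> E \<omega>} = {\<omega>. E \<omega>}"
    by (auto simp: space_path_law)
  moreover have "y.prob {\<omega>. \<not> E \<omega>} < 1"
    using assms by (simp add: transient_state_def space_path_law E_def)
  ultimately have r: "r = ennreal (y.prob {\<omega>. E \<omega>})" "y.prob {\<omega>. E \<omega>} > 0"
    by (simp_all add: r_def y.emeasure_eq_measure)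
  have S: "{\<omega>. \<omega> n = y \<and> E (path_shift n \<omega>)} \<in> sets (path_law p x)" "{\<omega>. \<omega> n = y} \<in> sets (path_law p x)" for n
    by (simp_all add: sets_path_law Collect_in_sets_path_space)
  have "disjoint_family (\<lambda>n. {\<omega>. \<omega> n = y \<and> E (path_shift n \<omega>)})"
  proof -
    have "n = m" if "\<omega> n = y" "E (path_shift n \<omega>)" "\<omega> m = y" "E (path_shift m \<omega>)" for n m \<omega>
    proof (rule ccontr)
      assume "n \<noteq> m"
      then consider "m = n + (m - n)" "m - n > 0" | "n = m + (n - m)" "n - m > 0" by linarith
      then show False using that by cases (metis E_def path_shift_apply)+
    qed
    then show ?thesis by (auto simp: disjoint_family_on_def)
  qed
  then have "(\<Sum>n. emeasure (path_law p x) {\<omega>. \<omega> n = y \<and> E (path_shift n \<omega>)}) =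
    emeasure (path_law p x) (\<Union>n. {\<omega>. \<omega> n = y \<and> E (path_shift n \<omega>)})"
    using S by (intro suminf_emeasure) auto
  also have "\<dots> \<le> 1" by (rule x.emeasure_le_1)
  finally have "(\<Sum>n. emeasure (path_law p x) {\<omega>. \<omega> n = y} * r) \<le> 1"
    by (simp add: emeasure_path_law_shift_at[OF E] r_def)
  then have *: "(\<Sum>n. emeasure (path_law p x) {\<omega>. \<omega> n = y}) * r \<le> 1"
    by simp
  \<comment> \<open>The escape probability \<open>r\<close> is positive, so the expected number of
    visits is finite and Borel-Cantelli applies.\<close>
  have "(\<Sum>n. emeasure (path_law p x) {\<omega>. \<omega> n = y}) \<noteq> \<top>"
    using * r by (auto simp: ennreal_top_mult top_unique)
  then have "AE \<omega> in path_law p x. eventually (\<lambda>n. \<omega> \<in> space (path_law p x) - {\<omega>. \<omega> n = y}) sequentially"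
    using S by (intro borel_cantelli_AE1 summable_suminf_not_top)
      (auto simp: x.emeasure_eq_measure less_top[symmetric])
  then show ?thesis
    by eventually_elim (simp add: eventually_sequentially space_path_law)
qed

section \<open>Laws of abstract chains and of permuted chains\<close>

lemma distr_markov_chain:
  fixes p :: "'s :: countable \<Rightarrow> 's pmf"
  assumes "prob_space M" and X: "markov_chain M p x X"
  shows "distr M path_space (\<lambda>\<omega> m. X m \<omega>) = path_law p x"
proof -
  interpret prob_space M by fact
  have [measurable]: "X n \<in> measurable M (count_space UNIV)" for n
    using X by (simp add: markov_chain_def)
  have m [measurable]: "(\<lambda>\<omega> m. X m \<omega>) \<in> measurable M path_space"
    by (rule measurable_path_spaceI) measurable
  have S: "{\<omega>. \<forall>i<n. \<omega> i = s i} \<in> sets path_space" for n and s :: "nat \<Rightarrow> 's"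
    by (rule Collect_in_sets_path_space) measurable
  have em: "emeasure (distr M path_space (\<lambda>\<omega> m. X m \<omega>)) {\<omega>. \<forall>i<n. \<omega> i = s i} =
    \<P>(\<omega> in M. \<forall>i<n. X i \<omega> = s i)" for n s
    by (subst emeasure_distr[OF m S]) (auto simp: emeasure_eq_measure intro!: arg_cong[where f=prob])
  show ?thesis
  proof (rule path_law_unique)
    show "prob_space (distr M path_space (\<lambda>\<omega> m. X m \<omega>))"
      by (rule prob_space_distr) measurable
    fix n s
    show "emeasure (distr M path_space (\<lambda>\<omega> m. X m \<omega>)) {\<omega>. \<forall>i<Suc n. \<omega> i = s i} =
      emeasure (distr M path_space (\<lambda>\<omega> m. X m \<omega>)) {\<omega>. \<forall>i<n. \<omega> i = s i} * emeasure (chain_step p x n s) {s n}"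
    proof (cases n)
      case 0
      have start: "AE \<omega> in M. X 0 \<omega> = x" using X by (simp add: markov_chain_def)
      have "\<P>(\<omega> in M. X 0 \<omega> = s 0) = \<P>(\<omega> in M. x = s 0)"
        by (rule finite_measure_eq_AE) (use start in auto)
      also have "\<dots> = (if x = s 0 then 1 else 0)" by (simp add: prob_space)
      finally show ?thesis
        unfolding em by (simp add: 0 emeasure_pmf_single prob_space)
    next
      case (Suc k)
      let ?A = "\<lambda>\<omega>. \<forall>i\<le>k. X i \<omega> = s i"
      have "\<P>(\<omega> in M. X (Suc k) \<omega> = s (Suc k) \<and> ?A \<omega>) = \<P>(\<omega> in M. ?A \<omega>) * pmf (p (s k)) (s (Suc k))"
      proof (cases "\<P>(\<omega> in M. ?A \<omega>) > 0")
        case True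
        with X have "\<P>(\<omega> in M. X (Suc k) \<omega> = s (Suc k) \<bar> ?A \<omega>) = pmf (p (s k)) (s (Suc k))"
          by (simp add: markov_chain_def)
        with True show ?thesis by (simp add: cond_prob_def field_simps)
      next
        \<comment> \<open>The conditional probability is prescribed only for conditioning events of
          positive mass; otherwise both sides of the recursion vanish.\<close>
        case False
        then have "\<P>(\<omega> in M. ?A \<omega>) = 0" by (simp add: zero_less_measure_iff)
        moreover have "\<P>(\<omega> in M. X (Suc k) \<omega> = s (Suc k) \<and> ?A \<omega>) \<le> \<P>(\<omega> in M. ?A \<omega>)"
          by (rule finite_measure_mono) auto
        ultimately show ?thesis by (simp add: measure_le_0_iff)
      qed
      moreover have "(\<forall>i<Suc n. X i \<omega> = s i) \<longleftrightarrow> X (Suc k) \<omega> = s (Suc k) \<and> ?A \<omega>" for \<omega>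
        using Suc by (auto simp: less_Suc_eq_le le_Suc_eq)
      moreover have "(\<forall>i<n. X i \<omega> = s i) \<longleftrightarrow> ?A \<omega>" for \<omega>
        using Suc by (auto simp: less_Suc_eq_le)
      ultimately show ?thesis
        unfolding em by (simp add: Suc emeasure_pmf_single ennreal_mult)
    qed
  qed simp
qed

text \<open>A cylinder for the image chain is a cylinder for the original chain over the states
  pulled back by \<rho>, the inverse of \<pi>; invariance of \<open>p\<close> matches the step
  laws.\<close>

lemma distr_path_law_permutation:
  fixes p :: "'s :: countable \<Rightarrow> 's pmf"
  assumes "bij \<pi>" and inv: "\<And>x y. pmf (p (\<pi> x)) (\<pi> y) = pmf (p x) y"
  shows "distr (path_law p x) path_space (\<lambda>\<omega> i. \<pi> (\<omega> i)) = path_law p (\<pi> x)"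
proof -
  have m [measurable]: "(\<lambda>\<omega> i. \<pi> (\<omega> i)) \<in> measurable (path_law p x) path_space"
    by (rule measurable_path_spaceI) measurable
  have S: "{\<omega>. \<forall>i<n. \<omega> i = s i} \<in> sets path_space" for n and s :: "nat \<Rightarrow> 's"
    by (rule Collect_in_sets_path_space) measurable
  define \<rho> where "\<rho> = the_inv \<pi>"
  have \<rho>: "\<pi> a = b \<longleftrightarrow> a = \<rho> b" for a b
    unfolding \<rho>_def using \<open>bij \<pi>\<close> by (metis bij_def the_inv_f_f f_the_inv_into_f_bij_betw UNIV_I)
  have \<pi>\<rho>: "\<pi> (\<rho> b) = b" for b using \<rho> by blast
  have em: "emeasure (distr (path_law p x) path_space (\<lambda>\<omega> i. \<pi> (\<omega> i))) {\<omega>. \<forall>i<n. \<omega> i = s i} =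
    emeasure (path_law p x) {\<omega>. \<forall>i<n. \<omega> i = \<rho> (s i)}" for n s
    by (subst emeasure_distr[OF m S]) (simp add: space_path_law vimage_def \<rho>)
  show ?thesis
  proof (rule path_law_unique)
    show "prob_space (distr (path_law p x) path_space (\<lambda>\<omega> i. \<pi> (\<omega> i)))"
      by (rule prob_space.prob_space_distr[OF prob_space_path_law]) measurable
    fix n s
    have "emeasure (chain_step p x n (\<lambda>i. \<rho> (s i))) {\<rho> (s n)} = emeasure (chain_step p (\<pi> x) n s) {s n}"
    proof (cases n)
      case 0
      then show ?thesis using \<rho>[of x "s 0"] by (auto simp: emeasure_pmf_single)
    next
      case (Suc k)
      then show ?thesis using inv[of "\<rho> (s k)" "\<rho> (s n)"] by (simp add: emeasure_pmf_single \<pi>\<rho>)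
    qed
    then show "emeasure (distr (path_law p x) path_space (\<lambda>\<omega> i. \<pi> (\<omega> i))) {\<omega>. \<forall>i<Suc n. \<omega> i = s i} =
      emeasure (distr (path_law p x) path_space (\<lambda>\<omega> i. \<pi> (\<omega> i))) {\<omega>. \<forall>i<n. \<omega> i = s i} *
      emeasure (chain_step p (\<pi> x) n s) {s n}"
      unfolding em using emeasure_path_law_cylinder_Suc[of p x n "\<lambda>i. \<rho> (s i)"] by simp
  qed simp
qed

section \<open>Pairs of independent chains\<close>

abbreviation pair_law :: "('s :: countable \<Rightarrow> 's pmf) \<Rightarrow> 's \<Rightarrow> 's \<Rightarrow> ((nat \<Rightarrow> 's) \<times> (nat \<Rightarrow> 's)) measure" where
  "pair_law p x y \<equiv> path_law p x \<Otimes>\<^sub>M path_law p y"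

abbreviation pred2 :: "((nat \<Rightarrow> 's) \<Rightarrow> (nat \<Rightarrow> 's) \<Rightarrow> bool) \<Rightarrow> bool" where
  "pred2 E \<equiv> Measurable.pred (path_space \<Otimes>\<^sub>M path_space) (\<lambda>z. E (fst z) (snd z))"

lemma prob_space_pair_law: "prob_space (pair_law p x y)"
  by (intro prob_space_pair prob_space_path_law)

lemma sets_pair_law [measurable_cong]: "sets (pair_law p x y) = sets (path_space \<Otimes>\<^sub>M path_space)"
  by (intro sets_pair_measure_cong sets_path_law)

lemma space_pair_law: "space (pair_law p x y) = UNIV"
  by (simp add: space_pair_measure space_path_law)

lemma pred2_compose:
  assumes "pred2 E" "f \<in> measurable M path_space" "g \<in> measurable M path_space"
  shows "Measurable.pred M (\<lambda>x. E (f x) (g x))"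
  using measurable_compose[OF measurable_Pair[OF assms(2,3)] assms(1)] by simp

lemma pred2_left: "pred2 E \<Longrightarrow> Measurable.pred path_space (E \<xi>)"
  by (rule pred2_compose[of E "\<lambda>_. \<xi>" _ "\<lambda>\<eta>. \<eta>"]) (simp_all add: space_PiM)

lemma pred2_right: "pred2 E \<Longrightarrow> Measurable.pred path_space (\<lambda>\<xi>. E \<xi> \<eta>)"
  by (rule pred2_compose[of E "\<lambda>\<xi>. \<xi>" _ "\<lambda>_. \<eta>"]) (simp_all add: space_PiM)

lemma Collect_in_sets_pair_law:
  "pred2 E \<Longrightarrow> {z. E (fst z) (snd z)} \<in> sets (pair_law p x y)"
  by (drule predE) (simp add: sets_pair_law space_pair_measure space_PiM)

lemma emeasure_pair_law_left:
  assumes "pred2 E"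
  shows "emeasure (pair_law p x y) {z. E (fst z) (snd z)} =
    (\<integral>\<^sup>+ \<xi>. emeasure (path_law p y) {\<eta>. E \<xi> \<eta>} \<partial>path_law p x)"
proof -
  interpret y: prob_space "path_law p y" by (rule prob_space_path_law)
  show ?thesis
    using y.emeasure_pair_measure_alt[OF Collect_in_sets_pair_law[OF assms]]
    by (simp add: vimage_def)
qed

lemma emeasure_pair_law_right:
  assumes "pred2 E"
  shows "emeasure (pair_law p x y) {z. E (fst z) (snd z)} =
    (\<integral>\<^sup>+ \<eta>. emeasure (path_law p x) {\<xi>. E \<xi> \<eta>} \<partial>path_law p y)"
proof -
  interpret x: prob_space "path_law p x" by (rule prob_space_path_law)
  interpret y: prob_space "path_law p y" by (rule prob_space_path_law)
  interpret pair_sigma_finite "path_law p x" "path_law p y" ..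
  show ?thesis
    using emeasure_pair_measure_alt2[OF Collect_in_sets_pair_law[OF assms]]
    by (simp add: vimage_def)
qed

section \<open>Approximation of events by the finite past\<close>

definition adapted2 :: "nat \<Rightarrow> ((nat \<Rightarrow> 's) \<Rightarrow> (nat \<Rightarrow> 's) \<Rightarrow> bool) \<Rightarrow> bool" where
  "adapted2 k A \<longleftrightarrow> (\<forall>\<xi> \<xi>' \<eta> \<eta>'. (\<forall>i<k. \<xi> i = \<xi>' i \<and> \<eta> i = \<eta>' i) \<longrightarrow> A \<xi> \<eta> = A \<xi>' \<eta>')"

lemma adapted2D:
  "adapted2 k A \<Longrightarrow> (\<And>i. i < k \<Longrightarrow> \<xi> i = \<xi>' i) \<Longrightarrow> (\<And>i. i < k \<Longrightarrow> \<eta> i = \<eta>' i) \<Longrightarrow> A \<xi> \<eta> = A \<xi>' \<eta>'"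
  unfolding adapted2_def by blast

lemma adapted2_mono: "adapted2 k A \<Longrightarrow> k \<le> l \<Longrightarrow> adapted2 l A"
  unfolding adapted2_def by (meson less_le_trans)

text \<open>The events that can be approximated form a sigma-algebra for which every coordinate is
  measurable, so they exhaust the product sigma-algebra.\<close>

lemma approximation_by_adapted:
  fixes Q :: "((nat \<Rightarrow> 's :: countable) \<times> (nat \<Rightarrow> 's)) measure"
  assumes Q: "finite_measure Q" and sets [measurable_cong]: "sets Q = sets (path_space \<Otimes>\<^sub>M path_space)"
    and S: "S \<in> sets Q" and e: "e > 0"
  obtains k A where "A \<in> sets Q" "adapted2 k (\<lambda>\<xi> \<eta>. (\<xi>, \<eta>) \<in> A)" "measure Q ((S - A) \<union> (A - S)) < e"
proof -
  interpret finite_measure Q by fact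
  have spQ: "space Q = UNIV"
    using sets_eq_imp_space_eq[OF sets] by (simp add: space_PiM space_pair_measure)
  define approx where "approx S e \<longleftrightarrow> (\<exists>k A. A \<in> sets Q \<and> adapted2 k (\<lambda>\<xi> \<eta>. (\<xi>, \<eta>) \<in> A) \<and>
    measure Q ((S - A) \<union> (A - S)) < e)" for S e
  define D where "D = {S \<in> sets Q. \<forall>e>0. approx S e}"
  have D0: "S \<in> D" if "S \<in> sets Q" "adapted2 k (\<lambda>\<xi> \<eta>. (\<xi>, \<eta>) \<in> S)" for S k
    using that by (auto simp: D_def approx_def intro!: exI[of _ k] exI[of _ S])
  have alg: "algebra UNIV D"
    unfolding algebra_iff_Un
  proof (intro conjI ballI)
    show "D \<subseteq> Pow UNIV" by simp
    show "{} \<in> D" by (rule D0[of _ 0]) (auto simp: adapted2_def)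
  next
    fix a assume a: "a \<in> D"
    show "UNIV - a \<in> D"
      unfolding D_def
    proof safe
      show "UNIV - a \<in> sets Q" using a sets.compl_sets[of a Q] by (simp add: D_def spQ)
      fix e :: real assume "e > 0"
      with a obtain k A where A: "A \<in> sets Q" "adapted2 k (\<lambda>\<xi> \<eta>. (\<xi>, \<eta>) \<in> A)"
        "measure Q ((a - A) \<union> (A - a)) < e"
        by (auto simp: D_def approx_def)
      have "UNIV - A \<in> sets Q" using A(1) sets.compl_sets[of A Q] by (simp add: spQ)
      moreover have "adapted2 k (\<lambda>\<xi> \<eta>. (\<xi>, \<eta>) \<in> UNIV - A)"
        using A(2) by (simp add: adapted2_def)
      moreover have "((UNIV - a) - (UNIV - A)) \<union> ((UNIV - A) - (UNIV - a)) = (a - A) \<union> (A - a)"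
        by blast
      ultimately show "approx (UNIV - a) e"
        unfolding approx_def using A(3) by metis
    qed
  next
    fix a b assume a: "a \<in> D" and b: "b \<in> D"
    show "a \<union> b \<in> D"
      unfolding D_def
    proof safe
      show "a \<union> b \<in> sets Q" using a b by (auto simp: D_def)
      fix e :: real assume "e > 0"
      with a obtain k A where A: "A \<in> sets Q" "adapted2 k (\<lambda>\<xi> \<eta>. (\<xi>, \<eta>) \<in> A)"
        "measure Q ((a - A) \<union> (A - a)) < e / 2"
        by (auto simp: D_def approx_def dest!: spec[of _ "e / 2"])
      from \<open>e > 0\<close> b obtain l B where B: "B \<in> sets Q" "adapted2 l (\<lambda>\<xi> \<eta>. (\<xi>, \<eta>) \<in> B)"
        "measure Q ((b - B) \<union> (B - b)) < e / 2"
        by (auto simp: D_def approx_def dest!: spec[of _ "e / 2"])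
      have "adapted2 (max k l) (\<lambda>\<xi> \<eta>. (\<xi>, \<eta>) \<in> A)" "adapted2 (max k l) (\<lambda>\<xi> \<eta>. (\<xi>, \<eta>) \<in> B)"
        using A(2) B(2) by (auto intro: adapted2_mono)
      then have "adapted2 (max k l) (\<lambda>\<xi> \<eta>. (\<xi>, \<eta>) \<in> A \<union> B)"
        unfolding adapted2_def Un_iff by blast
      moreover have "measure Q (((a \<union> b) - (A \<union> B)) \<union> ((A \<union> B) - (a \<union> b))) \<le>
        measure Q (((a - A) \<union> (A - a)) \<union> ((b - B) \<union> (B - b)))"
        using a b A(1) B(1) by (intro finite_measure_mono) (auto simp: D_def)
      moreover have "\<dots> \<le> measure Q ((a - A) \<union> (A - a)) + measure Q ((b - B) \<union> (B - b))"
        using a b A(1) B(1) by (intro measure_Un_le) (auto simp: D_def)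
      ultimately show "approx (a \<union> b) e"
        unfolding approx_def using A(1,3) B(1,3) by (intro exI[of _ "max k l"] exI[of _ "A \<union> B"]) auto
    qed
  qed
  interpret D: algebra UNIV D by (rule alg)
  have sig: "sigma_algebra UNIV D"
    unfolding sigma_algebra_iff
  proof (intro conjI alg allI impI)
    fix F :: "nat \<Rightarrow> _" assume F: "range F \<subseteq> D"
    \<comment> \<open>Half of \<open>e\<close> pays for replacing the countable union by the finite
      union \<open>T n\<close>, the other half for approximating \<open>T n\<close>.\<close>
    define T where "T n = (\<Union>i<n. F i)" for n
    have T: "T n \<in> D" for n
      unfolding T_def using F by (intro D.finite_UN) auto
    have TQ: "T n \<in> sets Q" for n using T by (simp add: D_def)
    have inc: "incseq T" unfolding T_def by (intro monoI UN_mono) auto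
    have U: "(\<Union>i. F i) = (\<Union>n. T n)" unfolding T_def by auto
    have UQ: "(\<Union>n. T n) \<in> sets Q" using TQ by auto
    have lim: "(\<lambda>n. measure Q (T n)) \<longlonglongrightarrow> measure Q (\<Union>n. T n)"
      using TQ inc by (intro finite_Lim_measure_incseq) auto
    show "(\<Union>i. F i) \<in> D"
      unfolding D_def U
    proof safe
      show "(\<Union>n. T n) \<in> sets Q" by (rule UQ)
      fix e :: real assume e: "e > 0"
      then have "eventually (\<lambda>n. measure Q (T n) > measure Q (\<Union>n. T n) - e / 2) sequentially"
        using lim by (intro order_tendstoD) auto
      then obtain n where n: "measure Q (T n) > measure Q (\<Union>n. T n) - e / 2"
        by (auto simp: eventually_sequentially)
      from e T[of n] obtain k A where A: "A \<in> sets Q" "adapted2 k (\<lambda>\<xi> \<eta>. (\<xi>, \<eta>) \<in> A)"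
        "measure Q ((T n - A) \<union> (A - T n)) < e / 2"
        by (auto simp: D_def approx_def dest!: spec[of _ "e / 2"])
      have "measure Q (((\<Union>n. T n) - A) \<union> (A - (\<Union>n. T n))) \<le>
        measure Q (((T n - A) \<union> (A - T n)) \<union> ((\<Union>n. T n) - T n))"
        using A(1) TQ UQ by (intro finite_measure_mono) auto
      also have "\<dots> \<le> measure Q ((T n - A) \<union> (A - T n)) + measure Q ((\<Union>n. T n) - T n)"
        using A(1) TQ UQ by (intro measure_Un_le) auto
      also have "measure Q ((\<Union>n. T n) - T n) = measure Q (\<Union>n. T n) - measure Q (T n)"
        using TQ UQ by (intro finite_measure_Diff) auto
      finally show "approx (\<Union>n. T n) e"
        unfolding approx_def using A n by (intro exI[of _ k] exI[of _ A]) auto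
    qed
  qed
  interpret D: sigma_algebra UNIV D by (rule sig)
  let ?D = "measure_of UNIV D (\<lambda>_. 0)"
  have sD: "sets ?D = D" by (rule D.sets_measure_of_eq)
  have spD: "space ?D = UNIV" by (simp add: space_measure_of_conv)
  have coord: "f \<in> measurable ?D (count_space UNIV)"
    if f [measurable]: "f \<in> measurable Q (count_space UNIV)"
      and "\<And>y. adapted2 k (\<lambda>\<xi> \<eta>. f (\<xi>, \<eta>) = y)" for f :: "_ \<Rightarrow> 's" and k
    unfolding measurable_count_space_eq2_countable
  proof (intro conjI ballI)
    fix y
    have "f -` {y} \<inter> space Q \<in> sets Q" by (rule measurable_sets[OF f]) simp
    then show "f -` {y} \<inter> space ?D \<in> sets ?D"
      unfolding sD spD using that(2)[of y] by (intro D0[of _ k]) (simp_all add: spQ)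
  qed (simp add: spD)
  \<comment> \<open>Measurability of the identity with respect to the approximable events says that
    every measurable event is one of them.\<close>
  have "(\<lambda>z. (fst z, snd z)) \<in> measurable ?D (path_space \<Otimes>\<^sub>M path_space)"
  proof (intro measurable_Pair measurable_path_spaceI)
    fix n
    show "(\<lambda>z. fst z n) \<in> measurable ?D (count_space UNIV)"
      by (rule coord[of _ "Suc n"]) (measurable, auto simp: adapted2_def)
    show "(\<lambda>z. snd z n) \<in> measurable ?D (count_space UNIV)"
      by (rule coord[of _ "Suc n"]) (measurable, auto simp: adapted2_def)
  qed
  from measurable_sets[OF this, of S] have "S \<in> D"
    using S sD sets spD by (simp add: vimage_def)
  then show ?thesis
    using e that by (auto simp: D_def approx_def)
qed

section \<open>Transfer from infinitely many intersections to a shift-invariant event\<close>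

definition meets_after :: "nat \<Rightarrow> (nat \<Rightarrow> 's) \<Rightarrow> (nat \<Rightarrow> 's) \<Rightarrow> bool" where
  "meets_after N \<xi> \<eta> \<longleftrightarrow> (\<exists>m\<ge>N. \<exists>n\<ge>N. \<xi> m = \<eta> n)"

lemma pred2_meets_after [measurable]: "pred2 (meets_after N :: (nat \<Rightarrow> 's :: countable) \<Rightarrow> _)"
  unfolding meets_after_def by measurable

text \<open>A reverse Markov inequality: integrate the pointwise bound of \<open>f\<close> by
  \<open>c\<close> plus the indicator of \<open>c \<le> f\<close>, valid because
  \<open>f \<le> 1\<close>.\<close>

lemma ge_half_mean_prob:
  assumes "prob_space Q" and f [measurable]: "f \<in> borel_measurable Q"
    and le: "\<And>\<omega>. f \<omega> \<le> 1" and mean: "2 * ennreal c \<le> (\<integral>\<^sup>+ \<omega>. f \<omega> \<partial>Q)"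
  shows "ennreal c \<le> emeasure Q {\<omega> \<in> space Q. ennreal c \<le> f \<omega>}"
proof -
  interpret prob_space Q by fact
  have "2 * ennreal c \<le> (\<integral>\<^sup>+ \<omega>. ennreal c + indicator {\<omega> \<in> space Q. ennreal c \<le> f \<omega>} \<omega> \<partial>Q)"
  proof (rule order_trans[OF mean], rule nn_integral_mono)
    fix \<omega> assume "\<omega> \<in> space Q"
    show "f \<omega> \<le> ennreal c + indicator {\<omega> \<in> space Q. ennreal c \<le> f \<omega>} \<omega>"
      using le[of \<omega>] \<open>\<omega> \<in> space Q\<close> by (auto split: split_indicator simp: not_le intro: add_increasing)
  qed
  also have "\<dots> = ennreal c + emeasure Q {\<omega> \<in> space Q. ennreal c \<le> f \<omega>}"
    by (simp add: nn_integral_add emeasure_space_1)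
  finally have "ennreal c + ennreal c \<le> ennreal c + emeasure Q {\<omega> \<in> space Q. ennreal c \<le> f \<omega>}"
    by (simp add: mult_2)
  then show ?thesis
    by (simp add: ennreal_add_left_cancel_le)
qed

lemma measurable_emeasure_section:
  assumes \<Phi>: "pred2 \<Phi>" and f [measurable]: "f \<in> measurable M path_space"
    and h: "h \<in> measurable M (count_space UNIV)"
  shows "(\<lambda>x. emeasure (path_law p (h x)) {\<eta>. \<Phi> (f x) \<eta>}) \<in> borel_measurable M"
  by (rule measurable_emeasure_path_law[OF h], rule pred2_compose[OF \<Phi>]) measurable

lemma measurable_emeasure_section1:
  assumes "pred2 \<Phi>"
  shows "(\<lambda>\<xi>. emeasure (path_law p y) {\<eta>. \<Phi> \<xi> \<eta>}) \<in> borel_measurable path_space"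
  by (rule measurable_emeasure_section[OF assms]) simp_all

lemma measurable_emeasure_section2:
  assumes "pred2 \<Phi>"
  shows "(\<lambda>\<eta>. emeasure (path_law p x) {\<xi>. \<Phi> \<xi> \<eta>}) \<in> borel_measurable path_space"
  by (rule measurable_emeasure_section1[of "\<lambda>\<eta> \<xi>. \<Phi> \<xi> \<eta>"])
    (rule pred2_compose[OF assms measurable_snd measurable_fst])

text \<open>Two first-entrance arguments, each costing a factor \<open>c\<close>. With \<eta> fixed,
  \<xi> is stopped on its first visit after time \<open>N\<close> to the part of \<eta> after time
  \<open>N\<close>, and its future is exposed. Then, with \<xi> fixed, \<eta> is stopped on its
  first visit after \<open>N\<close> to a state from which \<Phi> has conditional probability at
  least \<open>c\<close>. As \<open>k \<le> N\<close>, both stops come after \<open>A\<close> is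
  decided.\<close>

lemma meets_after_bound:
  fixes p :: "'s :: countable \<Rightarrow> 's pmf"
  assumes \<Phi> [measurable]: "pred2 \<Phi>"
    and shift_inv: "\<And>\<xi> \<eta> n. \<Phi> \<xi> (path_shift n \<eta>) = \<Phi> \<xi> \<eta>"
    and lower: "\<And>m \<omega>. 2 * ennreal c \<le>
      emeasure (pair_law p (\<omega> m) (\<omega> m)) {z. \<Phi> (glue m \<omega> (fst z)) (snd z)}"
    and A [measurable]: "pred2 A" and adapted: "adapted2 k A" and k: "k \<le> N"
  shows "ennreal c * (ennreal c * emeasure (pair_law p x y) {z. A (fst z) (snd z) \<and> meets_after N (fst z) (snd z)})
    \<le> emeasure (pair_law p x y) {z. A (fst z) (snd z) \<and> \<Phi> (fst z) (snd z)}"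
proof -
  \<comment> \<open>The conditional probability of \<Phi> given the whole path \<xi>, for a fresh
    second chain started at \<open>y\<close>.\<close>
  define g where "g \<xi> y = emeasure (path_law p y) {\<eta>. \<Phi> \<xi> \<eta>}" for \<xi> y
  have g_le: "g \<xi> y \<le> 1" for \<xi> y
    unfolding g_def by (rule prob_space.emeasure_le_1[OF prob_space_path_law])
  have g2 [measurable]: "(\<lambda>z. g (fst z) (snd z n)) \<in> borel_measurable (path_space \<Otimes>\<^sub>M path_space)" for n
    unfolding g_def by (rule measurable_emeasure_section[OF \<Phi>]) measurable
  have g1 [measurable]: "(\<lambda>\<xi>. g \<xi> y) \<in> borel_measurable path_space" for y
    unfolding g_def by (rule measurable_emeasure_section1[OF \<Phi>])
  let ?M = "\<lambda>\<xi> \<eta>. A \<xi> \<eta> \<and> meets_after N \<xi> \<eta>"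
  let ?B = "\<lambda>\<xi> \<eta>. A \<xi> \<eta> \<and> (\<exists>m\<ge>N. \<exists>n\<ge>N. \<xi> m = \<eta> n \<and> ennreal c \<le> g \<xi> (\<eta> n))"
  let ?C = "\<lambda>\<xi> \<eta>. A \<xi> \<eta> \<and> (\<exists>n\<ge>N. ennreal c \<le> g \<xi> (\<eta> n))"
  have M: "pred2 ?M" by measurable
  have B: "pred2 ?B" by measurable
  have C: "pred2 ?C" by measurable
  have AP: "pred2 (\<lambda>\<xi> \<eta>. A \<xi> \<eta> \<and> \<Phi> \<xi> \<eta>)" by measurable
  \<comment> \<open>\<open>adapted2 k\<close> looks only at coordinates below \<open>k\<close>,
    while \<open>adapted m\<close> includes coordinate \<open>m\<close>, so the present state may
    enter the stopping condition.\<close>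
  have adapted_left: "adapted m (\<lambda>\<xi>. N \<le> m \<and> A \<xi> \<eta> \<and> R (\<xi> m))" for m \<eta> and R :: "'s \<Rightarrow> bool"
  proof (cases "N \<le> m")
    case True
    then have "A \<xi> \<eta> = A \<xi>' \<eta>" if "\<forall>i\<le>m. \<xi> i = \<xi>' i" for \<xi> \<xi>'
      by (intro adapted2D[OF adapted]) (use that k in auto)
    then show ?thesis unfolding adapted_def by (intro allI impI) (metis order_refl)
  qed (simp add: adapted_def)
  have adapted_right: "adapted n (\<lambda>\<eta>. N \<le> n \<and> A \<xi> \<eta> \<and> R (\<eta> n))" for n \<xi> and R :: "'s \<Rightarrow> bool"
  proof (cases "N \<le> n")
    case True
    then have "A \<xi> \<eta> = A \<xi> \<eta>'" if "\<forall>i\<le>n. \<eta> i = \<eta>' i" for \<eta> \<eta>'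
      by (intro adapted2D[OF adapted]) (use that k in auto)
    then show ?thesis unfolding adapted_def by (intro allI impI) (metis order_refl)
  qed (simp add: adapted_def)
  have "ennreal c * emeasure (pair_law p x y) {z. ?M (fst z) (snd z)} =
    (\<integral>\<^sup>+ \<eta>. ennreal c * emeasure (path_law p x) {\<xi>. ?M \<xi> \<eta>} \<partial>path_law p y)"
    unfolding emeasure_pair_law_right[OF M]
    by (rule nn_integral_cmult[symmetric], subst measurable_cong_sets[OF sets_path_law refl],
      rule measurable_emeasure_section2[OF M])
  also have "\<dots> \<le> (\<integral>\<^sup>+ \<eta>. emeasure (path_law p x) {\<xi>. ?B \<xi> \<eta>} \<partial>path_law p y)"
  proof (rule nn_integral_mono)
    fix \<eta>
    let ?R = "\<lambda>m \<xi>. N \<le> m \<and> A \<xi> \<eta> \<and> (\<exists>n\<ge>N. \<xi> m = \<eta> n)"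
    have [measurable]: "Measurable.pred path_space (\<lambda>\<xi>. A \<xi> \<eta>)" by (rule pred2_right) (rule A)
    have "ennreal c * emeasure (path_law p x) {\<xi>. \<exists>m. ?R m \<xi>} \<le> emeasure (path_law p x) {\<xi>. ?B \<xi> \<eta>}"
    proof (rule first_entrance_bound)
      show "Measurable.pred path_space (?R m)" for m by measurable
      show "Measurable.pred path_space (\<lambda>\<xi>. ?B \<xi> \<eta>)" by (rule pred2_right[OF B])
      show "adapted m (?R m)" for m by (rule adapted_left)
      fix m \<omega> assume R: "?R m \<omega>"
      have [measurable]: "(\<lambda>\<omega>'. g (glue m \<omega> \<omega>') y) \<in> borel_measurable path_space" for y
        unfolding g_def by (rule measurable_emeasure_section[OF \<Phi>]) measurable
      \<comment> \<open>This is \<open>lower\<close> with the product measure integrated in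
        sections. The mean of \<open>g\<close> over the future of \<xi> is at least
        \<open>2 * c\<close>, so \<open>g\<close> is at least \<open>c\<close> with probability at
        least \<open>c\<close>.\<close>
      have "2 * ennreal c \<le> (\<integral>\<^sup>+ \<xi>. g (glue m \<omega> \<xi>) (\<omega> m) \<partial>path_law p (\<omega> m))"
        using lower[of \<omega> m] unfolding g_def
        by (subst (asm) emeasure_pair_law_left) (rule pred2_compose[OF \<Phi>], measurable)
      then have "ennreal c \<le> emeasure (path_law p (\<omega> m)) {\<xi> \<in> space (path_law p (\<omega> m)). ennreal c \<le> g (glue m \<omega> \<xi>) (\<omega> m)}"
        by (intro ge_half_mean_prob g_le prob_space_path_law) measurable
      also have "\<dots> \<le> emeasure (path_law p (\<omega> m)) {\<omega>'. \<omega>' 0 = \<omega> m \<longrightarrow> ?B (glue m \<omega> \<omega>') \<eta>}"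
      proof -
        have "?B (glue m \<omega> \<omega>') \<eta>" if "\<omega>' 0 = \<omega> m" "ennreal c \<le> g (glue m \<omega> \<omega>') (\<omega> m)" for \<omega>'
        proof
          show "A (glue m \<omega> \<omega>') \<eta>"
            using adapted2D[OF adapted, of "glue m \<omega> \<omega>'" \<omega> \<eta> \<eta>] R k by simp
          from R obtain n where "N \<le> m" "N \<le> n" "\<omega> m = \<eta> n" by blast
          moreover have "glue m \<omega> \<omega>' m = \<omega> m" using that(1) by (simp add: glue_def)
          ultimately show "\<exists>m'\<ge>N. \<exists>n\<ge>N. glue m \<omega> \<omega>' m' = \<eta> n \<and> ennreal c \<le> g (glue m \<omega> \<omega>') (\<eta> n)"
            using that(2) by (intro exI[of _ m] exI[of _ n] conjI) simp_all
        qed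
        moreover have "Measurable.pred path_space (\<lambda>\<omega>'. \<omega>' 0 = \<omega> m \<longrightarrow> ?B (glue m \<omega> \<omega>') \<eta>)" by measurable
        ultimately show ?thesis
          unfolding space_path_law
          by (intro emeasure_path_law_mono) auto
      qed
      finally show "ennreal c \<le> emeasure (path_law p (\<omega> m)) {\<omega>'. \<omega>' 0 = \<omega> m \<longrightarrow> ?B (glue m \<omega> \<omega>') \<eta>}" .
    qed
    also have "{\<xi>. \<exists>m. ?R m \<xi>} = {\<xi>. ?M \<xi> \<eta>}" by (auto simp: meets_after_def)
    finally show "ennreal c * emeasure (path_law p x) {\<xi>. ?M \<xi> \<eta>} \<le> emeasure (path_law p x) {\<xi>. ?B \<xi> \<eta>}" .
  qed
  also have "\<dots> = emeasure (pair_law p x y) {z. ?B (fst z) (snd z)}"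
    by (rule emeasure_pair_law_right[OF B, symmetric])
  \<comment> \<open>The meeting index on \<xi> is dropped: from here on only the state visited by
    \<eta> matters.\<close>
  also have "\<dots> \<le> emeasure (pair_law p x y) {z. ?C (fst z) (snd z)}"
    by (intro emeasure_mono Collect_in_sets_pair_law[OF C]) blast
  finally have "ennreal c * emeasure (pair_law p x y) {z. ?M (fst z) (snd z)} \<le>
    emeasure (pair_law p x y) {z. ?C (fst z) (snd z)}" .
  then have "ennreal c * (ennreal c * emeasure (pair_law p x y) {z. ?M (fst z) (snd z)}) \<le>
    ennreal c * emeasure (pair_law p x y) {z. ?C (fst z) (snd z)}"
    by (rule mult_left_mono) simp
  also have "\<dots> = (\<integral>\<^sup>+ \<xi>. ennreal c * emeasure (path_law p y) {\<eta>. ?C \<xi> \<eta>} \<partial>path_law p x)"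
    unfolding emeasure_pair_law_left[OF C]
    by (rule nn_integral_cmult[symmetric], subst measurable_cong_sets[OF sets_path_law refl],
      rule measurable_emeasure_section1[OF C])
  also have "\<dots> \<le> (\<integral>\<^sup>+ \<xi>. emeasure (path_law p y) {\<eta>. A \<xi> \<eta> \<and> \<Phi> \<xi> \<eta>} \<partial>path_law p x)"
  proof (rule nn_integral_mono)
    fix \<xi>
    let ?R = "\<lambda>n \<eta>. N \<le> n \<and> A \<xi> \<eta> \<and> ennreal c \<le> g \<xi> (\<eta> n)"
    have [measurable]: "Measurable.pred path_space (A \<xi>)" "Measurable.pred path_space (\<Phi> \<xi>)"
      by (rule pred2_left, fact)+
    have "ennreal c * emeasure (path_law p y) {\<eta>. \<exists>n. ?R n \<eta>} \<le> emeasure (path_law p y) {\<eta>. A \<xi> \<eta> \<and> \<Phi> \<xi> \<eta>}"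
    proof (rule first_entrance_bound)
      have [measurable]: "(\<lambda>\<eta>. g \<xi> (\<eta> n)) \<in> borel_measurable path_space" for n
        by (rule measurable_compose[of "\<lambda>\<eta>. \<eta> n" _ "count_space UNIV"]) measurable
      show "Measurable.pred path_space (?R n)" for n by measurable
      show "Measurable.pred path_space (\<lambda>\<eta>. A \<xi> \<eta> \<and> \<Phi> \<xi> \<eta>)" by measurable
      show "adapted n (?R n)" for n by (rule adapted_right)
      fix n \<omega> assume R: "?R n \<omega>"
      then have "ennreal c \<le> emeasure (path_law p (\<omega> n)) {\<eta>. \<Phi> \<xi> \<eta>}" by (simp add: g_def)
      also have "\<dots> \<le> emeasure (path_law p (\<omega> n)) {\<omega>'. \<omega>' 0 = \<omega> n \<longrightarrow> A \<xi> (glue n \<omega> \<omega>') \<and> \<Phi> \<xi> (glue n \<omega> \<omega>')}"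
      proof (rule emeasure_path_law_mono)
        show "Measurable.pred path_space (\<lambda>\<omega>'. \<omega>' 0 = \<omega> n \<longrightarrow> A \<xi> (glue n \<omega> \<omega>') \<and> \<Phi> \<xi> (glue n \<omega> \<omega>'))"
          by measurable
        \<comment> \<open>Shift invariance discards the past of \<eta>: the glued path satisfies
          \<Phi> as soon as the fresh piece does.\<close>
        fix \<omega>' assume "\<Phi> \<xi> \<omega>'"
        then have "\<Phi> \<xi> (glue n \<omega> \<omega>')" using shift_inv[of \<xi> n "glue n \<omega> \<omega>'"] by simp
        moreover have "A \<xi> (glue n \<omega> \<omega>')"
          using adapted2D[OF adapted, of \<xi> \<xi> "glue n \<omega> \<omega>'" \<omega>] R k by simp
        ultimately show "\<omega>' 0 = \<omega> n \<longrightarrow> A \<xi> (glue n \<omega> \<omega>') \<and> \<Phi> \<xi> (glue n \<omega> \<omega>')" by simp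
      qed
      finally show "ennreal c \<le> emeasure (path_law p (\<omega> n)) {\<omega>'. \<omega>' 0 = \<omega> n \<longrightarrow> A \<xi> (glue n \<omega> \<omega>') \<and> \<Phi> \<xi> (glue n \<omega> \<omega>')}" .
    qed
    also have "{\<eta>. \<exists>n. ?R n \<eta>} = {\<eta>. ?C \<xi> \<eta>}" by auto
    finally show "ennreal c * emeasure (path_law p y) {\<eta>. ?C \<xi> \<eta>} \<le> emeasure (path_law p y) {\<eta>. A \<xi> \<eta> \<and> \<Phi> \<xi> \<eta>}" .
  qed
  also have "\<dots> = emeasure (pair_law p x y) {z. A (fst z) (snd z) \<and> \<Phi> (fst z) (snd z)}"
    by (rule emeasure_pair_law_left[OF AP, symmetric])
  finally show ?thesis .
qed

text \<open>The bad event \<open>S\<close>, where \<Phi> fails, is approximated by an event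
  \<open>A\<close> of the finite past. On \<open>A\<close>, infinitely many intersections force
  \<Phi> to occur with a proportional probability, yet \<Phi> meets \<open>A\<close> only in the
  approximation error. Letting the error tend to 0 makes \<open>L \<inter> S\<close> null.\<close>

theorem meets_infinitely_often_imp:
  fixes p :: "'s :: countable \<Rightarrow> 's pmf"
  assumes \<Phi> [measurable]: "pred2 \<Phi>"
    and shift_inv: "\<And>\<xi> \<eta> n. \<Phi> \<xi> (path_shift n \<eta>) = \<Phi> \<xi> \<eta>"
    and c: "c > 0"
    and lower: "\<And>m \<omega>. 2 * ennreal c \<le>
      emeasure (pair_law p (\<omega> m) (\<omega> m)) {z. \<Phi> (glue m \<omega> (fst z)) (snd z)}"
  shows "AE z in pair_law p x y. (\<forall>N. meets_after N (fst z) (snd z)) \<longrightarrow> \<Phi> (fst z) (snd z)"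
proof -
  let ?Q = "pair_law p x y"
  interpret prob_space ?Q by (rule prob_space_pair_law)
  define L where "L = {z :: (nat \<Rightarrow> 's) \<times> (nat \<Rightarrow> 's). \<forall>N. meets_after N (fst z) (snd z)}"
  define S where "S = {z. \<not> \<Phi> (fst z) (snd z)}"
  have L: "L \<in> sets ?Q"
    unfolding L_def by (rule Collect_in_sets_pair_law[where E="\<lambda>\<xi> \<eta>. \<forall>N. meets_after N \<xi> \<eta>"]) measurable
  have S: "S \<in> sets ?Q"
    unfolding S_def by (rule Collect_in_sets_pair_law[where E="\<lambda>\<xi> \<eta>. \<not> \<Phi> \<xi> \<eta>"]) measurable
  \<comment> \<open>The summand \<open>e\<close> bounds the mass of \<open>A - S\<close>; the
    summand \<open>c * c * e\<close> pays for replacing \<open>S\<close> by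
    \<open>A\<close>.\<close>
  have bound: "c * (c * prob (L \<inter> S)) \<le> (1 + c * c) * e" if e: "e > 0" for e
  proof -
    obtain k A where A: "A \<in> sets ?Q" "adapted2 k (\<lambda>\<xi> \<eta>. (\<xi>, \<eta>) \<in> A)" "prob ((S - A) \<union> (A - S)) < e"
      by (rule approximation_by_adapted[OF finite_measure_axioms sets_pair_law S e])
    have [measurable]: "A \<in> sets (path_space \<Otimes>\<^sub>M path_space)"
      using A(1) by (simp only: sets_pair_law)
    have A2 [measurable]: "pred2 (\<lambda>\<xi> \<eta>. (\<xi>, \<eta>) \<in> A)"
      by measurable
    have MA: "{z. (fst z, snd z) \<in> A \<and> meets_after k (fst z) (snd z)} \<in> sets ?Q"
      by (rule Collect_in_sets_pair_law[where E="\<lambda>\<xi> \<eta>. (\<xi>, \<eta>) \<in> A \<and> meets_after k \<xi> \<eta>"]) measurable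
    have "ennreal c * (ennreal c * emeasure ?Q (A \<inter> L)) \<le> ennreal c * (ennreal c *
        emeasure ?Q {z. (fst z, snd z) \<in> A \<and> meets_after k (fst z) (snd z)})"
      using MA by (intro mult_left_mono emeasure_mono) (auto simp: L_def)
    also have "\<dots> \<le> emeasure ?Q {z. (fst z, snd z) \<in> A \<and> \<Phi> (fst z) (snd z)}"
      by (rule meets_after_bound[OF \<Phi> shift_inv lower A2 A(2) order_refl])
    also have "\<dots> \<le> emeasure ?Q (A - S)"
      using A(1) S by (intro emeasure_mono) (auto simp: S_def)
    finally have "c * (c * prob (A \<inter> L)) \<le> prob (A - S)"
      using c by (simp add: emeasure_eq_measure ennreal_mult[symmetric])
    also have "\<dots> \<le> prob ((S - A) \<union> (A - S))"
      using A(1) S by (intro finite_measure_mono) auto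
    finally have 1: "c * (c * prob (A \<inter> L)) \<le> e" using A(3) by simp
    have "prob (L \<inter> S) \<le> prob ((A \<inter> L) \<union> ((S - A) \<union> (A - S)))"
      using A(1) S L by (intro finite_measure_mono) auto
    also have "\<dots> \<le> prob (A \<inter> L) + prob ((S - A) \<union> (A - S))"
      using A(1) S L by (intro measure_Un_le) auto
    finally have "prob (L \<inter> S) \<le> prob (A \<inter> L) + e" using A(3) by simp
    then have "(c * c) * prob (L \<inter> S) \<le> (c * c) * (prob (A \<inter> L) + e)"
      using c by (intro mult_left_mono) auto
    with 1 show ?thesis by (simp add: algebra_simps)
  qed
  have "c * (c * prob (L \<inter> S)) \<le> 0"
  proof (rule field_le_epsilon)
    fix e :: real assume "e > 0"
    moreover have "1 + c * c > 0" using c by (simp add: add_pos_pos)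
    ultimately show "c * (c * prob (L \<inter> S)) \<le> 0 + e"
      using bound[of "e / (1 + c * c)"] by simp
  qed
  then have "prob (L \<inter> S) = 0"
    using c by (simp add: mult_le_0_iff measure_le_0_iff not_le)
  then have "AE z in ?Q. z \<notin> L \<inter> S"
    using L S by (intro AE_not_in) (auto simp: null_sets_def emeasure_eq_measure)
  then show ?thesis
    by eventually_elim (auto simp: L_def S_def)
qed

section \<open>Loop-erasure\<close>

text \<open>Loop-erasure of the finite piece up to time \<open>M\<close>, made total: once the last
  visit to the current point is at time \<open>M\<close>, the \<open>min\<close> keeps the sequence
  at \<open>v M\<close> forever.\<close>

primrec loop_erasure_upto :: "(nat \<Rightarrow> 's) \<Rightarrow> nat \<Rightarrow> nat \<Rightarrow> 's" where
  "loop_erasure_upto v M 0 = v 0"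
| "loop_erasure_upto v M (Suc j) =
    v (min M (Suc (GREATEST k. k \<le> M \<and> v k = loop_erasure_upto v M j)))"

lemma loop_erasure_upto_cong:
  assumes "\<And>i. i \<le> M \<Longrightarrow> v i = w i"
  shows "loop_erasure_upto v M j = loop_erasure_upto w M j"
proof (induction j)
  case (Suc j)
  have "(k \<le> M \<and> v k = loop_erasure_upto v M j) = (k \<le> M \<and> w k = loop_erasure_upto w M j)" for k
    using assms Suc by auto
  then show ?case using assms by simp
qed (simp add: assms)

lemma last_visit_upto:
  fixes v :: "nat \<Rightarrow> 's"
  assumes "k \<le> M" "v k = y"
  shows "(GREATEST k. k \<le> M \<and> v k = y) \<le> M" "v (GREATEST k. k \<le> M \<and> v k = y) = y"
    "k \<le> (GREATEST k. k \<le> M \<and> v k = y)"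
  using GreatestI_nat[of "\<lambda>k. k \<le> M \<and> v k = y" k M] Greatest_le_nat[of "\<lambda>k. k \<le> M \<and> v k = y" k M] assms
  by auto

lemma loop_erasure_upto_in_path: "\<exists>k\<le>M. v k = loop_erasure_upto v M j"
proof (cases j)
  case 0
  then show ?thesis by (intro exI[of _ 0]) simp
next
  case (Suc i)
  then show ?thesis unfolding Suc loop_erasure_upto.simps by (metis min.cobounded1)
qed

text \<open>The last-visit times of successive points increase strictly as long as they are below
  \<open>M\<close>, so they cannot stay below \<open>M\<close> for \<open>M + 1\<close>
  steps.\<close>

lemma loop_erasure_upto_reaches_end: "\<exists>j. loop_erasure_upto v M j = v M"
proof (rule ccontr)
  assume "\<not> ?thesis"
  then have no: "loop_erasure_upto v M j \<noteq> v M" for j by blast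
  define K where "K j = (GREATEST k. k \<le> M \<and> v k = loop_erasure_upto v M j)" for j
  have K: "K j \<le> M" "v (K j) = loop_erasure_upto v M j" for j
    using loop_erasure_upto_in_path[of M v j] last_visit_upto[of _ M v "loop_erasure_upto v M j"]
    by (auto simp: K_def)
  have less: "K j < M" for j
    using K[of j] no[of j] by (metis le_neq_implies_less)
  have "Suc (K j) \<le> K (Suc j)" for j
    unfolding K_def[of "Suc j"] using less[of j]
    by (intro last_visit_upto(3)) (auto simp: K_def)
  then have "j \<le> K j" for j
    by (induction j) (auto intro: order_trans[OF Suc_leI[OF le_imp_less_Suc]] dest: Suc_le_lessD)
  then show False using less[of M] by (simp add: not_less[symmetric])
qed

text \<open>If no point before index \<open>j\<close> is seen at or after time \<open>M\<close>, its
  last visit up to \<open>M\<close> is its last visit altogether. Point \<open>j\<close> itself may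
  be revisited later. The case \<open>t = M\<close> keeps the cap by \<open>min\<close> from
  acting.\<close>

lemma loop_erasure_eq_upto:
  assumes "\<And>i t. i < j \<Longrightarrow> M \<le> t \<Longrightarrow> loop_erasure_upto v M i \<noteq> v t"
  shows "loop_erasure v j = loop_erasure_upto v M j"
  using assms
proof (induction j)
  case (Suc j)
  define y where "y = loop_erasure_upto v M j"
  have IH: "loop_erasure v j = y" using Suc by (simp add: y_def)
  have "v k = y \<longleftrightarrow> k \<le> M \<and> v k = y" for k
    using Suc.prems[of j k] by (cases "k \<le> M") (auto simp: y_def)
  then have eq: "(GREATEST k. v k = y) = (GREATEST k. k \<le> M \<and> v k = y)" by meson
  obtain k where k: "k \<le> M" "v k = y"
    using loop_erasure_upto_in_path[of M v j] y_def by auto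
  note l = last_visit_upto[of k M v y, OF k]
  have "(GREATEST k. k \<le> M \<and> v k = y) \<noteq> M"
    using l(2) Suc.prems[of j M] by (auto simp: y_def)
  with l(1) have "min M (Suc (GREATEST k. k \<le> M \<and> v k = y)) = Suc (GREATEST k. k \<le> M \<and> v k = y)"
    by simp
  then show ?case by (simp add: IH eq y_def[symmetric])
qed simp

text \<open>Equivalently, the first point of \<open>L\<close> on \<open>b\<close> comes no later than the first one on \<open>a\<close>; this
  form needs no convention for the case that \<open>a\<close> avoids \<open>L\<close>.\<close>
definition cuts_earlier :: "(nat \<Rightarrow> 's) \<Rightarrow> (nat \<Rightarrow> 's) \<Rightarrow> (nat \<Rightarrow> 's) \<Rightarrow> bool" where
  "cuts_earlier L a b \<longleftrightarrow> (\<exists>j. L j \<in> range b \<and> (\<forall>i<j. L i \<notin> range a))"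

text \<open>Both paths start at a point of \<open>L\<close>, so each has a least index at which it
  meets \<open>L\<close>, and these two indices are comparable.\<close>

lemma cuts_earlier_linear:
  assumes "L j = a 0" "a 0 = b 0"
  shows "cuts_earlier L a b \<or> cuts_earlier L b a"
proof -
  define i where "i = (LEAST j. L j \<in> range a)"
  define k where "k = (LEAST j. L j \<in> range b)"
  have "L j \<in> range a" using assms(1) by simp
  moreover have "L j \<in> range b" using assms by simp
  ultimately have i: "L i \<in> range a" and k: "L k \<in> range b"
    unfolding i_def k_def by (metis LeastI)+
  have a: "L l \<notin> range a" if "l < i" for l using that not_less_Least unfolding i_def by metis
  have b: "L l \<notin> range b" if "l < k" for l using that not_less_Least unfolding k_def by metis
  show ?thesis
  proof (cases "k \<le> i")
    case True
    then have "\<forall>l<k. L l \<notin> range a" using a by simp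
    then show ?thesis unfolding cuts_earlier_def using k by blast
  next
    case False
    then have "\<forall>l<i. L l \<notin> range b" using b by simp
    then show ?thesis unfolding cuts_earlier_def using i by blast
  qed
qed

text \<open>The points of the current erasure before the one found on \<eta> avoid the future of
  \<xi>, so by \<open>loop_erasure_eq_upto\<close> that point survives in the final loop-erasure.
  Time \<open>k + m\<close> of the glued path is time \<open>m\<close> of \<xi>.\<close>

lemma cuts_earlier_meets_loop_erasure:
  assumes "cuts_earlier (loop_erasure_upto (glue k \<omega> \<xi>) (k + m)) (path_shift m \<xi>) (path_shift n \<eta>)"
  shows "\<exists>n'\<ge>n. \<eta> n' \<in> range (loop_erasure (glue k \<omega> \<xi>))"
proof -
  let ?v = "glue k \<omega> \<xi>" and ?L = "loop_erasure_upto (glue k \<omega> \<xi>) (k + m)"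
  obtain j n' where j: "?L j = \<eta> (n + n')" "\<And>i. i < j \<Longrightarrow> ?L i \<notin> range (path_shift m \<xi>)"
    using assms by (auto simp: cuts_earlier_def)
  have "loop_erasure ?v j = ?L j"
  proof (rule loop_erasure_eq_upto)
    fix i t assume "i < j" "k + m \<le> t"
    then have "?v t = path_shift m \<xi> (t - (k + m))" by (simp add: glue_def)
    then show "?L i \<noteq> ?v t" using j(2)[OF \<open>i < j\<close>] by (metis rangeI)
  qed
  then show ?thesis using j(1) by (intro exI[of _ "n + n'"]) (metis le_add1 rangeI)
qed

section \<open>Measurability of the loop-erasure\<close>

lemma measurable_Greatest:
  fixes P :: "nat \<Rightarrow> 'a \<Rightarrow> bool"
  assumes [measurable]: "\<And>i. Measurable.pred M (P i)"
  shows "(\<lambda>x. GREATEST i. P i x) \<in> measurable M (count_space UNIV)"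
proof -
  let ?Q = "\<lambda>i x. P i x \<and> (\<forall>j. P j x \<longrightarrow> j \<le> i)"
  \<comment> \<open>Without a greatest index, \<open>GREATEST\<close> is a fixed unspecified number,
    so measurability also covers the paths that visit a state infinitely often.\<close>
  have "(GREATEST i. P i x) = (if \<exists>i. ?Q i x then LEAST i. ?Q i x else (THE i. False))" for x
  proof (cases "\<exists>i. ?Q i x")
    case True
    then obtain i where i: "?Q i x" by blast
    have "(GREATEST i. P i x) = i" using i by (intro Greatest_equality) blast+
    moreover have "(LEAST i. ?Q i x) = i" using i by (intro Least_equality) blast+
    ultimately show ?thesis using True by simp
  next
    case False
    then have q: "?Q i x = False" for i by blast
    show ?thesis unfolding Greatest_def q by simp
  qed
  moreover have "(\<lambda>x. if \<exists>i. ?Q i x then LEAST i. ?Q i x else (THE i. False)) \<in> measurable M (count_space UNIV)"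
    by measurable
  ultimately show ?thesis by simp
qed

lemma measurable_at_index:
  fixes g :: "'a \<Rightarrow> nat"
  assumes f: "f \<in> measurable M path_space" and g: "g \<in> measurable M (count_space UNIV)"
  shows "(\<lambda>x. f x (g x)) \<in> measurable M (count_space UNIV)"
  by (rule measurable_compose_countable[OF measurable_coordinate[OF f] g])

lemma measurable_loop_erasure_upto:
  fixes f :: "'a \<Rightarrow> nat \<Rightarrow> 's :: countable"
  assumes f: "f \<in> measurable M path_space"
  shows "(\<lambda>x. loop_erasure_upto (f x) K j) \<in> measurable M (count_space UNIV)"
proof (induction j)
  case 0
  show ?case using measurable_coordinate[OF f] by simp
next
  case (Suc j)
  note [measurable] = Suc measurable_coordinate[OF f]
  have [measurable]: "(\<lambda>x. GREATEST k. k \<le> K \<and> f x k = loop_erasure_upto (f x) K j) \<in> measurable M (count_space UNIV)"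
    by (rule measurable_Greatest) measurable
  show ?case unfolding loop_erasure_upto.simps
    by (rule measurable_at_index[OF f]) measurable
qed

lemma measurable_loop_erasure:
  fixes f :: "'a \<Rightarrow> nat \<Rightarrow> 's :: countable"
  assumes f: "f \<in> measurable M path_space"
  shows "(\<lambda>x. loop_erasure (f x) j) \<in> measurable M (count_space UNIV)"
proof (induction j)
  case 0
  show ?case using measurable_coordinate[OF f] by simp
next
  case (Suc j)
  note [measurable] = Suc measurable_coordinate[OF f]
  have [measurable]: "(\<lambda>x. GREATEST k. f x k = loop_erasure (f x) j) \<in> measurable M (count_space UNIV)"
    by (rule measurable_Greatest) measurable
  show ?case unfolding loop_erasure.simps
    by (rule measurable_at_index[OF f]) measurable
qed

lemma pred_cuts_earlier [measurable (raw)]: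
  fixes L :: "'a \<Rightarrow> nat \<Rightarrow> 's :: countable"
  assumes "\<And>j. (\<lambda>x. L x j) \<in> measurable M (count_space UNIV)"
    and a: "a \<in> measurable M path_space" and b: "b \<in> measurable M path_space"
  shows "Measurable.pred M (\<lambda>x. cuts_earlier (L x) (a x) (b x))"
proof -
  note [measurable] = assms(1) measurable_coordinate[OF a] measurable_coordinate[OF b]
  have "Measurable.pred M (\<lambda>x. \<exists>j. (\<exists>k. L x j = b x k) \<and> (\<forall>i<j. \<not> (\<exists>k. L x i = a x k)))"
    by measurable
  then show ?thesis by (simp add: cuts_earlier_def image_iff)
qed

text \<open>Swapping the two i.i.d. paths preserves the law, and by
  \<open>cuts_earlier_linear\<close> the event and its mirror image together cover almost
  everything.\<close>

lemma cuts_earlier_half: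
  fixes p :: "'s :: countable \<Rightarrow> 's pmf"
  assumes "L j = z"
  shows "1 \<le> 2 * emeasure (pair_law p z z) {w. cuts_earlier L (fst w) (snd w)}"
proof -
  interpret prob_space "pair_law p z z" by (rule prob_space_pair_law)
  have C: "pred2 (\<lambda>a b. cuts_earlier L a b)" by measurable
  have C': "pred2 (\<lambda>a b. cuts_earlier L b a)" by measurable
  let ?Q = "pair_law p z z"
  have st: "AE w in ?Q. fst w 0 = z" "AE w in ?Q. snd w 0 = z"
  proof -
    interpret z: prob_space "path_law p z" by (rule prob_space_path_law)
    interpret pair_sigma_finite "path_law p z" "path_law p z" ..
    have 1: "AE a in path_law p z. AE b in path_law p z. a 0 = z"
      using AE_path_law_start[of z p] by eventually_elim simp
    have 2: "AE a in path_law p z. AE b in path_law p z. b 0 = z"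
      by (intro AE_I2 AE_path_law_start)
    show "AE w in ?Q. fst w 0 = z" by (rule AE_pair_measure) (measurable, use 1 in simp)
    show "AE w in ?Q. snd w 0 = z" by (rule AE_pair_measure) (measurable, use 2 in simp)
  qed
  have "1 = emeasure ?Q (space ?Q)" by (rule emeasure_space_1[symmetric])
  also have "\<dots> \<le> emeasure ?Q ({w. cuts_earlier L (fst w) (snd w)} \<union> {w. cuts_earlier L (snd w) (fst w)})"
  proof (rule emeasure_mono_AE)
    show "AE w in ?Q. w \<in> space ?Q \<longrightarrow>
        w \<in> {w. cuts_earlier L (fst w) (snd w)} \<union> {w. cuts_earlier L (snd w) (fst w)}"
      using st by eventually_elim (use assms cuts_earlier_linear[of L j] in auto)
    show "{w. cuts_earlier L (fst w) (snd w)} \<union> {w. cuts_earlier L (snd w) (fst w)} \<in> sets ?Q"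
      using Collect_in_sets_pair_law[OF C] Collect_in_sets_pair_law[OF C'] by (intro sets.Un)
  qed
  also have "\<dots> \<le> emeasure ?Q {w. cuts_earlier L (fst w) (snd w)} + emeasure ?Q {w. cuts_earlier L (snd w) (fst w)}"
    using Collect_in_sets_pair_law[OF C] Collect_in_sets_pair_law[OF C'] by (intro emeasure_subadditive)
  \<comment> \<open>The swap symmetry is read off from Fubini in the two orders of
    integration.\<close>
  also have "emeasure ?Q {w. cuts_earlier L (snd w) (fst w)} = emeasure ?Q {w. cuts_earlier L (fst w) (snd w)}"
    using emeasure_pair_law_left[OF C'] emeasure_pair_law_right[OF C] by simp
  finally show ?thesis by (simp add: mult_2)
qed

text \<open>Given that the chains are at \<open>z\<close> at times \<open>m\<close> and
  \<open>n\<close>, their futures are i.i.d. from \<open>z\<close>, while the erasure up to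
  \<open>k + m\<close> is a function of the past of the first chain and passes through
  \<open>z\<close>. So \<open>cuts_earlier_half\<close> applies conditionally, whatever the prefix
  \<omega>.\<close>

lemma cuts_earlier_at_intersection:
  fixes p :: "'s :: countable \<Rightarrow> 's pmf"
  shows "emeasure (path_law p x) {\<omega>. \<omega> m = z} * emeasure (path_law p x) {\<omega>. \<omega> n = z} \<le>
    2 * emeasure (pair_law p x x) {w. (fst w m = z \<and> snd w n = z) \<and>
      cuts_earlier (loop_erasure_upto (glue k \<omega> (fst w)) (k + m)) (path_shift m (fst w)) (path_shift n (snd w))}"
proof -
  let ?P = "path_law p x"
  let ?L = "\<lambda>\<xi>. loop_erasure_upto (glue k \<omega> \<xi>) (k + m)"
  let ?G = "\<lambda>\<xi> \<eta>. (\<xi> m = z \<and> \<eta> n = z) \<and> cuts_earlier (?L \<xi>) (path_shift m \<xi>) (path_shift n \<eta>)"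
  have L [measurable]: "(\<lambda>x. ?L (f x) j) \<in> measurable M (count_space UNIV)"
    if [measurable]: "f \<in> measurable M path_space" for f :: "(nat \<Rightarrow> 's) \<times> (nat \<Rightarrow> 's) \<Rightarrow> _" and M j
    by (rule measurable_loop_erasure_upto, rule measurable_glue[OF measurable_const that])
      (simp add: space_PiM)
  have G: "pred2 ?G" by measurable
  define f where "f \<xi> = emeasure (path_law p z) {b. cuts_earlier (?L \<xi>) (path_shift m \<xi>) b}" for \<xi>
  have f [measurable]: "f \<in> borel_measurable path_space"
    unfolding f_def by (rule measurable_emeasure_section1) measurable
  have zm: "{\<omega>. \<omega> m = z} \<in> sets path_space" by (rule Collect_in_sets_path_space) measurable
  note [measurable] = zm
  have C1: "pred2 (\<lambda>a b. cuts_earlier L a b)" for L :: "nat \<Rightarrow> 's" by measurable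
  have "emeasure (pair_law p x x) {w. ?G (fst w) (snd w)} = (\<integral>\<^sup>+ \<xi>. emeasure ?P {\<eta>. ?G \<xi> \<eta>} \<partial>?P)"
    by (rule emeasure_pair_law_left[OF G])
  \<comment> \<open>Markov property of the second chain at time \<open>n\<close>, with the whole
    path \<xi> frozen.\<close>
  also have "\<dots> = (\<integral>\<^sup>+ \<xi>. emeasure ?P {\<omega>. \<omega> n = z} * (indicator {\<omega>. \<omega> m = z} \<xi> * f \<xi>) \<partial>?P)"
  proof (rule nn_integral_cong)
    fix \<xi>
    have "Measurable.pred path_space (\<lambda>b. cuts_earlier (?L \<xi>) (path_shift m \<xi>) b)"
      by (rule pred2_left[OF C1])
    then show "emeasure ?P {\<eta>. ?G \<xi> \<eta>} = emeasure ?P {\<omega>. \<omega> n = z} * (indicator {\<omega>. \<omega> m = z} \<xi> * f \<xi>)"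
      using emeasure_path_law_shift_at[of "\<lambda>b. cuts_earlier (?L \<xi>) (path_shift m \<xi>) b" p x n z]
      by (simp add: f_def split: split_indicator)
  qed
  also have "\<dots> = emeasure ?P {\<omega>. \<omega> n = z} * (\<integral>\<^sup>+ \<xi>. indicator {\<omega>. \<omega> m = z} \<xi> * f \<xi> \<partial>?P)"
    by (rule nn_integral_cmult) measurable
  \<comment> \<open>Now the Markov property of the first chain at time \<open>m\<close>.\<close>
  also have "(\<integral>\<^sup>+ \<xi>. indicator {\<omega>. \<omega> m = z} \<xi> * f \<xi> \<partial>?P) =
    (\<integral>\<^sup>+ \<xi>. \<integral>\<^sup>+ \<xi>'. indicator {\<omega>. \<omega> m = z} (glue m \<xi> \<xi>') * f (glue m \<xi> \<xi>') \<partial>path_law p (\<xi> m) \<partial>?P)"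
    by (rule nn_integral_path_law_split) measurable
  also have "\<dots> = (\<integral>\<^sup>+ \<xi>. indicator {\<omega>. \<omega> m = z} \<xi> *
      emeasure (pair_law p z z) {w. cuts_earlier (?L \<xi>) (fst w) (snd w)} \<partial>?P)"
  proof (rule nn_integral_cong)
    fix \<xi>
    have "(\<integral>\<^sup>+ \<xi>'. indicator {\<omega>. \<omega> m = z} (glue m \<xi> \<xi>') * f (glue m \<xi> \<xi>') \<partial>path_law p (\<xi> m)) =
      (\<integral>\<^sup>+ \<xi>'. indicator {\<omega>. \<omega> m = z} \<xi> * emeasure (path_law p z) {b. cuts_earlier (?L \<xi>) \<xi>' b} \<partial>path_law p (\<xi> m))"
    proof (rule nn_integral_cong_AE, use AE_path_law_start in eventually_elim)
      fix \<xi>' :: "nat \<Rightarrow> 's" assume s: "\<xi>' 0 = \<xi> m"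
      have g: "glue m \<xi> \<xi>' i = \<xi> i" if "i \<le> m" for i
        using that s by (cases "i = m") (simp_all add: glue_def)
      \<comment> \<open>The erasure up to \<open>k + m\<close> reads \<xi> only up to time
        \<open>m\<close>, so it stays constant while the future is resampled.\<close>
      have "?L (glue m \<xi> \<xi>') = ?L \<xi>"
        by (rule ext, rule loop_erasure_upto_cong) (use g in \<open>simp add: glue_def[of k]\<close>)
      then show "indicator {\<omega>. \<omega> m = z} (glue m \<xi> \<xi>') * f (glue m \<xi> \<xi>') =
          indicator {\<omega>. \<omega> m = z} \<xi> * emeasure (path_law p z) {b. cuts_earlier (?L \<xi>) \<xi>' b}"
        using g[of m] by (simp add: f_def indicator_def)
    qed
    also have "\<dots> = indicator {\<omega>. \<omega> m = z} \<xi> *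
      emeasure (pair_law p z z) {w. cuts_earlier (?L \<xi>) (fst w) (snd w)}"
      by (simp add: emeasure_pair_law_left[OF C1] split: split_indicator)
    finally show "(\<integral>\<^sup>+ \<xi>'. indicator {\<omega>. \<omega> m = z} (glue m \<xi> \<xi>') * f (glue m \<xi> \<xi>') \<partial>path_law p (\<xi> m)) = \<dots>" .
  qed
  finally have eq: "emeasure (pair_law p x x) {w. ?G (fst w) (snd w)} = emeasure ?P {\<omega>. \<omega> n = z} *
    (\<integral>\<^sup>+ \<xi>. indicator {\<omega>. \<omega> m = z} \<xi> * emeasure (pair_law p z z) {w. cuts_earlier (?L \<xi>) (fst w) (snd w)} \<partial>?P)" .
  have "emeasure ?P {\<omega>. \<omega> m = z} = (\<integral>\<^sup>+ \<xi>. indicator {\<omega>. \<omega> m = z} \<xi> \<partial>?P)"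
    using zm by (simp add: sets_path_law)
  also have "\<dots> \<le> (\<integral>\<^sup>+ \<xi>. 2 * (indicator {\<omega>. \<omega> m = z} \<xi> *
      emeasure (pair_law p z z) {w. cuts_earlier (?L \<xi>) (fst w) (snd w)}) \<partial>?P)"
  proof (rule nn_integral_mono)
    fix \<xi>
    \<comment> \<open>The erasure reaches its endpoint, so the current state is one of its points,
      as \<open>cuts_earlier_half\<close> requires.\<close>
    obtain j where "?L \<xi> j = glue k \<omega> \<xi> (k + m)" using loop_erasure_upto_reaches_end by blast
    then have "?L \<xi> j = \<xi> m" by simp
    then show "indicator {\<omega>. \<omega> m = z} \<xi> \<le> 2 * (indicator {\<omega>. \<omega> m = z} \<xi> *
      emeasure (pair_law p z z) {w. cuts_earlier (?L \<xi>) (fst w) (snd w)})"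
      using cuts_earlier_half[of "?L \<xi>" j z p] by (simp split: split_indicator)
  qed
  also have "\<dots> = 2 * (\<integral>\<^sup>+ \<xi>. indicator {\<omega>. \<omega> m = z} \<xi> *
      emeasure (pair_law p z z) {w. cuts_earlier (?L \<xi>) (fst w) (snd w)} \<partial>?P)" (is "_ = 2 * ?I")
  proof (rule nn_integral_cmult)
    interpret zz: prob_space "pair_law p z z" by (rule prob_space_pair_law)
    have "Measurable.pred (path_space \<Otimes>\<^sub>M pair_law p z z) (\<lambda>u. cuts_earlier (?L (fst u)) (fst (snd u)) (snd (snd u)))"
      by (rule pred_cuts_earlier, rule measurable_loop_erasure_upto, rule measurable_glue[OF measurable_const])
        (simp add: space_PiM, measurable)
    then have "{u. cuts_earlier (?L (fst u)) (fst (snd u)) (snd (snd u))} \<in> sets (path_space \<Otimes>\<^sub>M pair_law p z z)"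
      by (drule_tac predE) (simp add: space_pair_measure space_PiM space_path_law)
    from zz.measurable_emeasure_Pair[OF this]
    have "(\<lambda>\<xi>. emeasure (pair_law p z z) {w. cuts_earlier (?L \<xi>) (fst w) (snd w)}) \<in> borel_measurable path_space"
      by (simp add: vimage_def)
    then show "(\<lambda>\<xi>. indicator {\<omega>. \<omega> m = z} \<xi> *
      emeasure (pair_law p z z) {w. cuts_earlier (?L \<xi>) (fst w) (snd w)}) \<in> borel_measurable ?P"
      by measurable
  qed
  finally have "emeasure ?P {\<omega>. \<omega> m = z} * emeasure ?P {\<omega>. \<omega> n = z} \<le> (2 * ?I) * emeasure ?P {\<omega>. \<omega> n = z}"
    by (rule mult_right_mono) simp
  also have "\<dots> = 2 * emeasure (pair_law p x x) {w. ?G (fst w) (snd w)}"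
    unfolding eq by (simp add: ac_simps)
  finally show ?thesis .
qed

section \<open>The second moment of the number of intersections\<close>

abbreviation occ :: "('s :: countable \<Rightarrow> 's pmf) \<Rightarrow> 's \<Rightarrow> nat \<Rightarrow> 's \<Rightarrow> ennreal" where
  "occ p x n z \<equiv> emeasure (path_law p x) {\<omega>. \<omega> n = z}"

definition green_upto :: "('s :: countable \<Rightarrow> 's pmf) \<Rightarrow> nat \<Rightarrow> 's \<Rightarrow> 's \<Rightarrow> ennreal" where
  "green_upto p K x z = (\<Sum>n<K. occ p x n z)"

text \<open>Integration against counting measure makes monotone convergence and Fubini directly
  available.\<close>

definition green_energy :: "('s :: countable \<Rightarrow> 's pmf) \<Rightarrow> nat \<Rightarrow> 's \<Rightarrow> ennreal" where
  "green_energy p K x = (\<integral>\<^sup>+ z. (green_upto p K x z)\<^sup>2 \<partial>count_space UNIV)"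

lemma nn_integral_occ: "(\<integral>\<^sup>+ z. occ p x n z \<partial>count_space UNIV) = 1"
proof -
  have S: "{\<omega>. \<omega> n = z} \<in> sets (path_law p x)" for z
    by (simp add: sets_path_law Collect_in_sets_path_space)
  have "(\<integral>\<^sup>+ z. occ p x n z \<partial>count_space UNIV) = emeasure (path_law p x) (\<Union>z. {\<omega>. \<omega> n = z})"
    by (rule emeasure_UN_countable[symmetric]) (auto simp: S disjoint_family_on_def)
  also have "(\<Union>z. {\<omega>. \<omega> n = z}) = UNIV" by auto
  finally show ?thesis by simp
qed

text \<open>The truncated Green function is at most \<open>K\<close> pointwise and has total mass
  \<open>K\<close>, so the energy is at most \<open>K * K\<close>.\<close>

lemma green_energy_finite: "green_energy p K x < \<top>"
proof -
  have occ_le: "occ p x n z \<le> 1" for n z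
    by (rule prob_space.emeasure_le_1[OF prob_space_path_law])
  have le: "green_upto p K x z \<le> of_nat K" for z
    unfolding green_upto_def using sum_mono[of "{..<K}" "\<lambda>n. occ p x n z" "\<lambda>_. 1"] occ_le by simp
  have "green_energy p K x \<le> (\<integral>\<^sup>+ z. of_nat K * green_upto p K x z \<partial>count_space UNIV)"
    unfolding green_energy_def power2_eq_square by (intro nn_integral_mono mult_right_mono le) simp
  also have "\<dots> = of_nat K * (\<Sum>n<K. \<integral>\<^sup>+ z. occ p x n z \<partial>count_space UNIV)"
    unfolding green_upto_def by (simp add: nn_integral_cmult nn_integral_sum)
  also have "\<dots> = of_nat (K * K)" by (simp add: nn_integral_occ)
  also have "\<dots> < \<top>" by (rule of_nat_less_top)
  finally show ?thesis .
qed

lemma green_upto_mono: "K \<le> L \<Longrightarrow> green_upto p K x z \<le> green_upto p L x z"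
  unfolding green_upto_def by (intro sum_mono2) auto

lemma green_energy_mono: "K \<le> L \<Longrightarrow> green_energy p K x \<le> green_energy p L x"
  unfolding green_energy_def by (intro nn_integral_mono power_mono green_upto_mono) auto

lemma green_energy_unbounded:
  assumes "(\<Sum>\<^sub>\<infinity>z. (green p x z)\<^sup>2) = \<infinity>"
  shows "(SUP K. green_energy p K x) = \<infinity>"
proof -
  have lim: "(\<lambda>K. green_upto p K x z) \<longlonglongrightarrow> green p x z" for z
    unfolding green_upto_def green_def
    by (simp add: space_path_law) (rule summable_LIMSEQ, simp)
  have "(\<lambda>K. (green_upto p K x z)\<^sup>2) \<longlonglongrightarrow> (green p x z)\<^sup>2" for z
    unfolding power2_eq_square by (intro tendsto_mult_ennreal lim) auto
  moreover have inc: "incseq (\<lambda>K. (green_upto p K x z)\<^sup>2)" for z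
    by (intro incseq_SucI power_mono green_upto_mono) auto
  ultimately have sup: "(SUP K. (green_upto p K x z)\<^sup>2) = (green p x z)\<^sup>2" for z
    using LIMSEQ_SUP LIMSEQ_unique by blast
  \<comment> \<open>For nonnegative terms the infinite sum is the supremum of its finite partial
    sums, so bounding these transfers the hypothesis to the integral.\<close>
  have "(\<Sum>z\<in>F. (green p x z)\<^sup>2) \<le> (\<integral>\<^sup>+ z. (green p x z)\<^sup>2 \<partial>count_space UNIV)" if "finite F" for F
  proof -
    have "(\<Sum>z\<in>F. (green p x z)\<^sup>2) = (\<integral>\<^sup>+ z. (green p x z)\<^sup>2 * indicator F z \<partial>count_space UNIV)"
      using that by (subst nn_integral_count_space'[of F]) (auto intro: sum.cong split: split_indicator)
    also have "\<dots> \<le> (\<integral>\<^sup>+ z. (green p x z)\<^sup>2 \<partial>count_space UNIV)"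
      by (intro nn_integral_mono) (auto split: split_indicator)
    finally show ?thesis .
  qed
  then have "(\<Sum>\<^sub>\<infinity>z. (green p x z)\<^sup>2) \<le> (\<integral>\<^sup>+ z. (green p x z)\<^sup>2 \<partial>count_space UNIV)"
    by (subst nonneg_infsum_complete) (auto intro: SUP_least)
  also have "\<dots> = (SUP K. green_energy p K x)"
    unfolding green_energy_def sup[symmetric]
    using inc by (intro nn_integral_monotone_convergence_SUP) (auto simp: incseq_def le_fun_def)
  finally show ?thesis using assms by (simp add: top_unique)
qed

lemma green_energy_permutation:
  fixes p :: "'s :: countable \<Rightarrow> 's pmf"
  assumes "bij \<pi>" and inv: "\<And>x y. pmf (p (\<pi> x)) (\<pi> y) = pmf (p x) y"
  shows "green_energy p K (\<pi> x) = green_energy p K x"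
proof -
  have m: "(\<lambda>\<omega> i. \<pi> (\<omega> i)) \<in> measurable (path_law p x) path_space"
    by (rule measurable_path_spaceI) measurable
  have "occ p (\<pi> x) n (\<pi> z) = occ p x n z" for n z
    unfolding distr_path_law_permutation[where \<pi>=\<pi> and p=p, OF assms, symmetric]
    using \<open>bij \<pi>\<close>
    by (subst emeasure_distr[OF m]) (auto simp: Collect_in_sets_path_space space_path_law vimage_def bij_def inj_eq)
  then have "green_energy p K x = (\<integral>\<^sup>+ z. (green_upto p K (\<pi> x) (\<pi> z))\<^sup>2 \<partial>count_space UNIV)"
    by (simp add: green_energy_def green_upto_def)
  also have "\<dots> = green_energy p K (\<pi> x)"
    unfolding green_energy_def by (rule nn_integral_bij_count_space) (rule \<open>bij \<pi>\<close>)
  finally show ?thesis ..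
qed

lemma emeasure_pair_law_Times:
  assumes E: "Measurable.pred path_space E" and F: "Measurable.pred path_space F"
  shows "emeasure (pair_law p x y) {w. E (fst w) \<and> F (snd w)} =
    emeasure (path_law p x) {\<omega>. E \<omega>} * emeasure (path_law p y) {\<omega>. F \<omega>}"
proof -
  interpret y: prob_space "path_law p y" by (rule prob_space_path_law)
  have "{w. E (fst w) \<and> F (snd w)} = {\<omega>. E \<omega>} \<times> {\<omega>. F \<omega>}" by auto
  then show ?thesis
    using assms by (simp add: y.emeasure_pair_measure_Times sets_path_law Collect_in_sets_path_space)
qed

text \<open>Split according to which visit comes first and apply the Markov property at that time;
  the gap between the two visits is still below \<open>K\<close>.\<close>

lemma joint_occ_le:
  fixes p :: "'s :: countable \<Rightarrow> 's pmf"
  shows "(\<Sum>m<K. \<Sum>n<K. emeasure (path_law p x) {\<omega>. \<omega> m = z \<and> \<omega> n = w}) \<le>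
    green_upto p K x z * green_upto p K z w + green_upto p K x w * green_upto p K w z"
proof -
  let ?J = "\<lambda>m n. emeasure (path_law p x) {\<omega>. \<omega> m = z \<and> \<omega> n = w}"
  have le: "emeasure (path_law p x) {\<omega>. \<omega> m = a \<and> \<omega> n = b} = occ p x m a * occ p a (n - m) b" if "m \<le> n" for m n a b
    using emeasure_path_law_shift_at[of "\<lambda>\<omega>. \<omega> (n - m) = b" p x m a] that by simp
  have sum: "(\<Sum>m<K. \<Sum>n<K. if m \<le> n then occ p x m a * occ p a (n - m) b else 0) \<le>
    green_upto p K x a * green_upto p K a b" for a b
  proof -
    have "(\<Sum>n<K. if m \<le> n then occ p x m a * occ p a (n - m) b else 0) \<le> occ p x m a * green_upto p K a b" for m
    proof -
      have "(\<Sum>n<K. if m \<le> n then occ p x m a * occ p a (n - m) b else 0) =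
        (\<Sum>n\<in>{m..<K}. occ p x m a * occ p a (n - m) b)"
        by (intro sum.mono_neutral_cong_right) auto
      also have "\<dots> = occ p x m a * (\<Sum>n\<in>{m..<K}. occ p a (n - m) b)"
        by (rule sum_distrib_left[symmetric])
      also have "(\<Sum>n\<in>{m..<K}. occ p a (n - m) b) = (\<Sum>d<K - m. occ p a d b)"
        by (rule sum.reindex_bij_witness[of _ "\<lambda>d. d + m" "\<lambda>n. n - m"]) auto
      also have "\<dots> \<le> green_upto p K a b"
        unfolding green_upto_def by (intro sum_mono2) auto
      finally show ?thesis by (simp add: mult_left_mono)
    qed
    then have "(\<Sum>m<K. \<Sum>n<K. if m \<le> n then occ p x m a * occ p a (n - m) b else 0) \<le>
      (\<Sum>m<K. occ p x m a * green_upto p K a b)" by (intro sum_mono)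
    also have "\<dots> = green_upto p K x a * green_upto p K a b"
      by (simp add: green_upto_def sum_distrib_right)
    finally show ?thesis .
  qed
  \<comment> \<open>The diagonal \<open>m = n\<close> is counted in both summands, which is harmless
    for an upper bound.\<close>
  have "(\<Sum>m<K. \<Sum>n<K. ?J m n) \<le> (\<Sum>m<K. \<Sum>n<K. (if m \<le> n then occ p x m z * occ p z (n - m) w else 0) +
    (if n \<le> m then occ p x n w * occ p w (m - n) z else 0))"
  proof (intro sum_mono)
    fix m n
    show "?J m n \<le> (if m \<le> n then occ p x m z * occ p z (n - m) w else 0) +
      (if n \<le> m then occ p x n w * occ p w (m - n) z else 0)"
    proof (cases "m \<le> n")
      case True
      then show ?thesis by (simp add: le[OF True])
    next
      case False
      then have "?J m n = occ p x n w * occ p w (m - n) z"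
        using le[of n m w z] by (simp add: conj_commute)
      then show ?thesis using False by simp
    qed
  qed
  also have "\<dots> = (\<Sum>m<K. \<Sum>n<K. if m \<le> n then occ p x m z * occ p z (n - m) w else 0) +
    (\<Sum>n<K. \<Sum>m<K. if n \<le> m then occ p x n w * occ p w (m - n) z else 0)"
    unfolding sum.distrib by (intro arg_cong2[where f="(+)"] refl sum.swap)
  also have "\<dots> \<le> green_upto p K x z * green_upto p K z w + green_upto p K x w * green_upto p K w z"
    by (intro add_mono sum)
  finally show ?thesis .
qed

lemma square_add_le_ennreal: "(a + b)\<^sup>2 \<le> 2 * a\<^sup>2 + 2 * (b :: ennreal)\<^sup>2"
proof (cases "a = \<top> \<or> b = \<top>")
  case True
  then show ?thesis by (auto simp: power2_eq_square ennreal_mult_top)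
next
  case False
  then obtain r s where rs: "a = ennreal r" "b = ennreal s" "0 \<le> r" "0 \<le> s"
    by (metis ennreal_cases)
  have ab: "(a + b)\<^sup>2 = ennreal ((r + s)\<^sup>2)"
    using rs by (simp add: ennreal_power ennreal_plus[symmetric] del: ennreal_plus)
  have "(r + s)\<^sup>2 \<le> 2 * r\<^sup>2 + 2 * s\<^sup>2"
    using sum_squares_bound[of r s] by (simp add: power2_sum)
  then have "ennreal ((r + s)\<^sup>2) \<le> ennreal (2 * r\<^sup>2 + 2 * s\<^sup>2)"
    by (rule ennreal_leI)
  then show ?thesis
    unfolding ab using rs by (simp add: ennreal_mult ennreal_power)
qed

lemma mult_le_squares_ennreal: "8 * (a * b) \<le> a\<^sup>2 + 16 * (b :: ennreal)\<^sup>2"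
proof (cases "a = \<top> \<or> b = \<top>")
  case True
  then show ?thesis by (auto simp: power2_eq_square ennreal_mult_top)
next
  case False
  then obtain r s where rs: "a = ennreal r" "b = ennreal s" "0 \<le> r" "0 \<le> s"
    by (metis ennreal_cases)
  have "8 * (r * s) \<le> r\<^sup>2 + 16 * s\<^sup>2"
    using zero_le_power2[of "r - 4 * s"] by (simp add: power2_diff power_mult_distrib)
  then have "ennreal (8 * (r * s)) \<le> ennreal (r\<^sup>2 + 16 * s\<^sup>2)"
    by (rule ennreal_leI)
  then show ?thesis
    using rs by (simp add: ennreal_plus ennreal_mult ennreal_power)
qed

text \<open>The square counts pairs of intersections, and independence turns its mean into the sum
  of the squares of \<open>H z w\<close> over pairs of sites. Each of the two orders of visits in
  \<open>joint_occ_le\<close> contributes twice the squared energy: by \<open>hom\<close> the inner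
  sum is the same energy from whichever site comes first.\<close>

lemma intersections_second_moment:
  fixes p :: "'s :: countable \<Rightarrow> 's pmf"
  assumes hom: "\<And>y. green_energy p K y = green_energy p K x"
  shows "(\<integral>\<^sup>+ w. (\<Sum>m<K. \<Sum>n<K. indicator {w. fst w m = snd w n} w)\<^sup>2 \<partial>pair_law p x x) \<le>
    4 * (green_energy p K x)\<^sup>2"
proof -
  let ?P = "path_law p x" and ?Q = "pair_law p x x"
  let ?G = "green_upto p K"
  have hom': "(\<integral>\<^sup>+ w. (?G z w)\<^sup>2 \<partial>count_space UNIV) = green_energy p K x" for z
    unfolding green_energy_def[symmetric] by (rule hom)
  define H where "H z w = (\<Sum>m<K. \<Sum>m'<K. emeasure ?P {\<omega>. \<omega> m = z \<and> \<omega> m' = w})" for z w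
  let ?E = "\<lambda>m n m' n'. {w. fst w m = snd w n \<and> fst w m' = snd w n'}"
  have E: "?E m n m' n' \<in> sets ?Q" for m n m' n'
    by (rule Collect_in_sets_pair_law[where E="\<lambda>\<xi> \<eta>. \<xi> m = \<eta> n \<and> \<xi> m' = \<eta> n'"]) measurable
  \<comment> \<open>Partition by the two sites at which the intersections take place, then use
    independence of the chains.\<close>
  have em: "emeasure ?Q (?E m n m' n') = (\<integral>\<^sup>+ u. emeasure ?P {\<omega>. \<omega> m = fst u \<and> \<omega> m' = snd u} *
      emeasure ?P {\<omega>. \<omega> n = fst u \<and> \<omega> n' = snd u} \<partial>count_space UNIV)" for m n m' n'
  proof -
    let ?F = "\<lambda>u. {w. (fst w m = fst u \<and> fst w m' = snd u) \<and> (snd w n = fst u \<and> snd w n' = snd u)}"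
    have F: "?F u \<in> sets ?Q" for u
      by (rule Collect_in_sets_pair_law[where E="\<lambda>\<xi> \<eta>. (\<xi> m = fst u \<and> \<xi> m' = snd u) \<and> (\<eta> n = fst u \<and> \<eta> n' = snd u)"])
        measurable
    have eq: "?E m n m' n' = (\<Union>u. ?F u)" by auto
    have "emeasure ?Q (\<Union>u. ?F u) = (\<integral>\<^sup>+ u. emeasure ?Q (?F u) \<partial>count_space UNIV)"
      using F by (intro emeasure_UN_countable) (auto simp: disjoint_family_on_def)
    moreover have "emeasure ?Q (?F u) = emeasure ?P {\<omega>. \<omega> m = fst u \<and> \<omega> m' = snd u} *
      emeasure ?P {\<omega>. \<omega> n = fst u \<and> \<omega> n' = snd u}" for u
      by (rule emeasure_pair_law_Times) measurable
    ultimately show ?thesis unfolding eq by (simp only:)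
  qed
  have "(\<integral>\<^sup>+ w. (\<Sum>m<K. \<Sum>n<K. indicator {w. fst w m = snd w n} w)\<^sup>2 \<partial>?Q) =
    (\<integral>\<^sup>+ w. (\<Sum>m<K. \<Sum>n<K. \<Sum>m'<K. \<Sum>n'<K. indicator (?E m n m' n') w) \<partial>?Q)"
  proof (rule nn_integral_cong)
    fix w :: "(nat \<Rightarrow> 's) \<times> (nat \<Rightarrow> 's)"
    have "(\<Sum>m<K. \<Sum>n<K. f m n)\<^sup>2 = (\<Sum>m<K. \<Sum>n<K. \<Sum>m'<K. \<Sum>n'<K. f m n * f m' n')"
      for f :: "nat \<Rightarrow> nat \<Rightarrow> ennreal"
      by (subst power2_eq_square, simp only: sum_distrib_right, simp only: sum_distrib_left)
    moreover have "indicator (?E m n m' n') w = (indicator {w. fst w m = snd w n} w *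
        indicator {w. fst w m' = snd w n'} w :: ennreal)" for m n m' n'
      by (simp split: split_indicator)
    ultimately show "(\<Sum>m<K. \<Sum>n<K. indicator {w. fst w m = snd w n} w)\<^sup>2 =
      (\<Sum>m<K. \<Sum>n<K. \<Sum>m'<K. \<Sum>n'<K. indicator (?E m n m' n') w :: ennreal)"
      by (simp only:)
  qed
  also have "\<dots> = (\<Sum>m<K. \<Sum>n<K. \<Sum>m'<K. \<Sum>n'<K. emeasure ?Q (?E m n m' n'))"
    using E by (simp add: nn_integral_sum)
  also have "\<dots> = (\<integral>\<^sup>+ u. (\<Sum>m<K. \<Sum>n<K. \<Sum>m'<K. \<Sum>n'<K. emeasure ?P {\<omega>. \<omega> m = fst u \<and> \<omega> m' = snd u} *
      emeasure ?P {\<omega>. \<omega> n = fst u \<and> \<omega> n' = snd u}) \<partial>count_space UNIV)"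
    by (simp add: em nn_integral_sum)
  also have "\<dots> = (\<integral>\<^sup>+ u. (H (fst u) (snd u))\<^sup>2 \<partial>count_space UNIV)"
  proof (rule nn_integral_cong)
    fix u
    let ?h = "\<lambda>m n. emeasure ?P {\<omega>. \<omega> m = fst u \<and> \<omega> n = snd u}"
    have "(\<Sum>m<K. \<Sum>n<K. \<Sum>m'<K. \<Sum>n'<K. ?h m m' * ?h n n') =
      (\<Sum>m<K. \<Sum>m'<K. \<Sum>n<K. \<Sum>n'<K. ?h m m' * ?h n n')"
      by (rule sum.cong[OF refl]) (rule sum.swap)
    also have "\<dots> = (H (fst u) (snd u))\<^sup>2"
      unfolding H_def
      by (subst power2_eq_square, simp only: sum_distrib_right, simp only: sum_distrib_left)
    finally show "(\<Sum>m<K. \<Sum>n<K. \<Sum>m'<K. \<Sum>n'<K. ?h m m' * ?h n n') = (H (fst u) (snd u))\<^sup>2" .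
  qed
  also have "\<dots> \<le> (\<integral>\<^sup>+ u. 2 * (?G x (fst u) * ?G (fst u) (snd u))\<^sup>2 + 2 * (?G x (snd u) * ?G (snd u) (fst u))\<^sup>2 \<partial>count_space UNIV)"
    unfolding H_def
    by (intro nn_integral_mono order_trans[OF power_mono[OF joint_occ_le] square_add_le_ennreal]) simp
  also have "\<dots> = 2 * (\<integral>\<^sup>+ u. (?G x (fst u) * ?G (fst u) (snd u))\<^sup>2 \<partial>count_space UNIV) +
    2 * (\<integral>\<^sup>+ u. (?G x (snd u) * ?G (snd u) (fst u))\<^sup>2 \<partial>count_space UNIV)"
    by (simp add: nn_integral_add nn_integral_cmult)
  also have "(\<integral>\<^sup>+ u. (?G x (fst u) * ?G (fst u) (snd u))\<^sup>2 \<partial>count_space UNIV) = (green_energy p K x)\<^sup>2"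
  proof -
    have "(\<integral>\<^sup>+ u. (?G x (fst u) * ?G (fst u) (snd u))\<^sup>2 \<partial>count_space UNIV) =
      (\<integral>\<^sup>+ z. \<integral>\<^sup>+ w. (?G x z)\<^sup>2 * (?G z w)\<^sup>2 \<partial>count_space UNIV \<partial>count_space UNIV)"
      by (subst nn_integral_fst_count_space[symmetric]) (simp add: power_mult_distrib)
    also have "\<dots> = (\<integral>\<^sup>+ z. (?G x z)\<^sup>2 * green_energy p K x \<partial>count_space UNIV)"
      by (simp only: nn_integral_cmult borel_measurable_count_space hom')
    finally show ?thesis by (simp add: nn_integral_multc green_energy_def power2_eq_square)
  qed
  also have "(\<integral>\<^sup>+ u. (?G x (snd u) * ?G (snd u) (fst u))\<^sup>2 \<partial>count_space UNIV) = (green_energy p K x)\<^sup>2"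
  proof -
    have "(\<integral>\<^sup>+ u. (?G x (snd u) * ?G (snd u) (fst u))\<^sup>2 \<partial>count_space UNIV) =
      (\<integral>\<^sup>+ z. \<integral>\<^sup>+ w. (?G x z)\<^sup>2 * (?G z w)\<^sup>2 \<partial>count_space UNIV \<partial>count_space UNIV)"
      by (subst nn_integral_snd_count_space[symmetric]) (simp add: power_mult_distrib)
    also have "\<dots> = (\<integral>\<^sup>+ z. (?G x z)\<^sup>2 * green_energy p K x \<partial>count_space UNIV)"
      by (simp only: nn_integral_cmult borel_measurable_count_space hom')
    finally show ?thesis by (simp add: nn_integral_multc green_energy_def power2_eq_square)
  qed
  finally show ?thesis by (simp add: mult.assoc[symmetric] distrib_right[symmetric])
qed

section \<open>Hitting the loop-erasure infinitely often\<close>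

lemma pred_in_range_loop_erasure:
  fixes f :: "'a \<Rightarrow> 's :: countable"
  assumes [measurable]: "f \<in> measurable M (count_space UNIV)" and g: "g \<in> measurable M path_space"
  shows "Measurable.pred M (\<lambda>x. f x \<in> range (loop_erasure (g x)))"
proof -
  note [measurable] = measurable_loop_erasure[OF g]
  have "Measurable.pred M (\<lambda>x. \<exists>j. f x = loop_erasure (g x) j)" by measurable
  then show ?thesis by (simp add: image_iff)
qed

text \<open>Second moment method for the intersections where the second chain has its index in
  \<open>{N..<K}\<close> and \<open>cuts_earlier\<close> holds. For \<open>K\<close> large, the
  indices below \<open>N\<close> account for at most a quarter of the energy, so the bound is
  uniform in \<open>N\<close> and in the prefix.\<close>

lemma loop_erasure_hit_bound:
  fixes p :: "'s :: countable \<Rightarrow> 's pmf"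
  assumes hom: "\<And>K y. green_energy p K y = green_energy p K x"
    and unbounded: "(SUP K. green_energy p K x) = \<infinity>"
  shows "ennreal (1 / 32) \<le> emeasure (pair_law p x x)
    {w. \<exists>n\<ge>N. snd w n \<in> range (loop_erasure (glue k \<omega> (fst w)))}"
proof -
  let ?P = "path_law p x" and ?Q = "pair_law p x x" and ?S = "\<lambda>K. green_energy p K x"
  interpret Q: prob_space ?Q by (rule prob_space_pair_law)
  \<comment> \<open>The factor 16 is that of \<open>mult_le_squares_ennreal\<close>, used below to
    split off the indices below \<open>N\<close>. The summand 1 makes the energy positive, so that
    it can be cancelled at the end.\<close>
  have "16 * ?S N + 1 < \<infinity>"
    using green_energy_finite[of p N x] by (simp add: ennreal_mult_less_top)
  then have "16 * ?S N + 1 < (SUP K. ?S K)"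
    by (simp only: unbounded)
  then obtain K where K: "16 * ?S N + 1 < ?S K"
    by (auto simp: less_SUP_iff)
  have NK: "N \<le> K"
  proof (rule ccontr)
    assume "\<not> N \<le> K"
    then have "?S K \<le> 1 * ?S N" using green_energy_mono[of K N p x] by simp
    also have "\<dots> \<le> 16 * ?S N + 1" by (intro add_increasing2 mult_right_mono) auto
    finally show False using K by simp
  qed
  let ?G = "green_upto p K x"
  define D where "D z = (\<Sum>n\<in>{N..<K}. occ p x n z)" for z
  have GD: "?G z = green_upto p N x z + D z" for z
    unfolding green_upto_def D_def using NK by (metis atLeast0LessThan le0 sum.atLeastLessThan_concat)
  let ?L = "\<lambda>\<xi> m. loop_erasure_upto (glue k \<omega> \<xi>) (k + m)"
  let ?C = "\<lambda>m n. {w. fst w m = snd w n \<and> cuts_earlier (?L (fst w) m) (path_shift m (fst w)) (path_shift n (snd w))}"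
  let ?Cz = "\<lambda>m n z. {w. (fst w m = z \<and> snd w n = z) \<and> cuts_earlier (?L (fst w) m) (path_shift m (fst w)) (path_shift n (snd w))}"
  let ?T = "{w. \<exists>n\<ge>N. snd w n \<in> range (loop_erasure (glue k \<omega> (fst w)))}"
  have gl: "(\<lambda>w. glue k \<omega> (fst w)) \<in> measurable (path_space \<Otimes>\<^sub>M path_space) path_space"
    by (rule measurable_glue[OF measurable_const]) (simp add: space_PiM, measurable)
  have Lm [measurable]: "(\<lambda>w. ?L (fst w) m j) \<in> measurable (path_space \<Otimes>\<^sub>M path_space) (count_space UNIV)" for m j
    by (rule measurable_loop_erasure_upto[OF gl])
  have C: "?C m n \<in> sets ?Q" for m n
    by (rule Collect_in_sets_pair_law[where E="\<lambda>\<xi> \<eta>. \<xi> m = \<eta> n \<and> cuts_earlier (?L \<xi> m) (path_shift m \<xi>) (path_shift n \<eta>)"])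
      measurable
  have Cz: "?Cz m n z \<in> sets ?Q" for m n z
    by (rule Collect_in_sets_pair_law[where E="\<lambda>\<xi> \<eta>. (\<xi> m = z \<and> \<eta> n = z) \<and> cuts_earlier (?L \<xi> m) (path_shift m \<xi>) (path_shift n \<eta>)"])
      measurable
  have "pred2 (\<lambda>\<xi> \<eta>. \<eta> n \<in> range (loop_erasure (glue k \<omega> \<xi>)))" for n
    by (rule pred_in_range_loop_erasure[OF _ gl]) measurable
  then have "pred2 (\<lambda>\<xi> \<eta>. \<exists>n\<ge>N. \<eta> n \<in> range (loop_erasure (glue k \<omega> \<xi>)))" by measurable
  then have T: "?T \<in> sets ?Q" by (rule Collect_in_sets_pair_law)
  have CT: "?C m n \<subseteq> ?T" if "n \<ge> N" for m n
  proof
    fix w assume "w \<in> ?C m n"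
    then obtain n' where "n \<le> n'" "snd w n' \<in> range (loop_erasure (glue k \<omega> (fst w)))"
      using cuts_earlier_meets_loop_erasure[of k \<omega> "fst w" m n "snd w"] by auto
    with that show "w \<in> ?T" by (auto intro!: exI[of _ n'])
  qed
  have occ_C: "(\<integral>\<^sup>+ z. occ p x m z * occ p x n z \<partial>count_space UNIV) \<le> 2 * emeasure ?Q (?C m n)" for m n
  proof -
    have "?C m n = (\<Union>z. ?Cz m n z)" by auto
    moreover have "emeasure ?Q (\<Union>z. ?Cz m n z) = (\<integral>\<^sup>+ z. emeasure ?Q (?Cz m n z) \<partial>count_space UNIV)"
      by (rule emeasure_UN_countable) (use Cz in \<open>auto simp: disjoint_family_on_def\<close>)
    ultimately have "2 * emeasure ?Q (?C m n) = (\<integral>\<^sup>+ z. 2 * emeasure ?Q (?Cz m n z) \<partial>count_space UNIV)"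
      by (simp only: nn_integral_cmult borel_measurable_count_space)
    then show ?thesis
      by (simp only:) (intro nn_integral_mono cuts_earlier_at_intersection)
  qed
  define J where "J w = (\<Sum>m<K. \<Sum>n\<in>{N..<K}. indicator (?C m n) w :: ennreal)" for w
  define e where "e = (\<Sum>m<K. \<Sum>n\<in>{N..<K}. Q.prob (?C m n))"
  have e0: "0 \<le> e" unfolding e_def by (intro sum_nonneg) auto
  have J [measurable]: "J \<in> borel_measurable ?Q"
    unfolding J_def using C by (intro borel_measurable_sum borel_measurable_indicator)
  have EJ: "(\<integral>\<^sup>+ w. J w \<partial>?Q) = ennreal e"
    unfolding J_def e_def using C by (simp add: nn_integral_sum Q.emeasure_eq_measure sum_nonneg)
  have "(\<integral>\<^sup>+ z. ?G z * D z \<partial>count_space UNIV) =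
    (\<Sum>m<K. \<Sum>n\<in>{N..<K}. \<integral>\<^sup>+ z. occ p x m z * occ p x n z \<partial>count_space UNIV)"
    unfolding green_upto_def D_def by (simp add: sum_product nn_integral_sum)
  also have "\<dots> \<le> (\<Sum>m<K. \<Sum>n\<in>{N..<K}. 2 * emeasure ?Q (?C m n))"
    by (intro sum_mono occ_C)
  also have "\<dots> = 2 * ennreal e"
    unfolding e_def by (simp add: Q.emeasure_eq_measure sum_nonneg sum_distrib_left[symmetric])
  finally have GD_le: "(\<integral>\<^sup>+ z. ?G z * D z \<partial>count_space UNIV) \<le> 2 * ennreal e" .
  \<comment> \<open>The cross term of \<open>?G\<close> with the Green function up to
    \<open>N\<close> is absorbed by \<open>mult_le_squares_ennreal\<close> and the choice of
    \<open>K\<close>. What remains is \<open>8 * s \<le> 2 * s + 16 * e\<close>, that is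
    \<open>3 * s \<le> 8 * e\<close>.\<close>
  have "8 * ?S K = (\<integral>\<^sup>+ z. 8 * (?G z * green_upto p N x z) + 8 * (?G z * D z) \<partial>count_space UNIV)"
    unfolding green_energy_def
    by (subst nn_integral_cmult[symmetric], simp, intro nn_integral_cong)
      (simp add: power2_eq_square GD distrib_left distrib_right)
  also have "\<dots> \<le> (\<integral>\<^sup>+ z. ((?G z)\<^sup>2 + 16 * (green_upto p N x z)\<^sup>2) + 8 * (?G z * D z) \<partial>count_space UNIV)"
    by (intro nn_integral_mono add_mono mult_le_squares_ennreal order_refl)
  also have "\<dots> = (?S K + 16 * ?S N) + 8 * (\<integral>\<^sup>+ z. ?G z * D z \<partial>count_space UNIV)"
    by (simp add: nn_integral_add nn_integral_cmult green_energy_def)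
  also have "\<dots> \<le> (?S K + (16 * ?S N + 1)) + 8 * (2 * ennreal e)"
    by (intro add_mono mult_left_mono GD_le) auto
  also have "\<dots> \<le> (?S K + ?S K) + 8 * (2 * ennreal e)"
    using K by (intro add_mono) auto
  finally have main: "8 * ?S K \<le> (?S K + ?S K) + 8 * (2 * ennreal e)" .
  obtain s where s: "?S K = ennreal s" "0 \<le> s"
    using green_energy_finite[of p K x] by (cases "?S K") auto
  have "1 < ?S K" using K by (metis le_less_trans add_increasing zero_le order_refl)
  then have s1: "1 < s" using s by (metis ennreal_1 ennreal_less_iff zero_le_one)
  have "8 * ennreal s \<le> 2 * ennreal s + 16 * ennreal e"
    using main s by (simp add: mult_2[of "ennreal s"])
  then have "ennreal (8 * s) \<le> ennreal (2 * s + 16 * e)"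
    using s e0 by (simp add: ennreal_mult)
  then have se: "3 * s \<le> 8 * e"
    using s e0 by (simp add: ennreal_le_iff del: ennreal_plus)
  \<comment> \<open>\<open>J\<close> vanishes outside \<open>?T\<close>, so by Cauchy-Schwarz its
    squared mean is at most its second moment times the probability of \<open>?T\<close>.\<close>
  have "(\<integral>\<^sup>+ w. J w * indicator ?T w \<partial>?Q)\<^sup>2 \<le> (\<integral>\<^sup>+ w. (J w)\<^sup>2 \<partial>?Q) * (\<integral>\<^sup>+ w. (indicator ?T w)\<^sup>2 \<partial>?Q)"
    by (rule Cauchy_Schwarz_nn_integral) (use T in measurable)
  also have "(\<integral>\<^sup>+ w. (indicator ?T w)\<^sup>2 \<partial>?Q) = (\<integral>\<^sup>+ w. indicator ?T w \<partial>?Q)"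
    by (intro nn_integral_cong) (simp split: split_indicator)
  also have "\<dots> = emeasure ?Q ?T" using T by simp
  also have "(\<integral>\<^sup>+ w. (J w)\<^sup>2 \<partial>?Q) \<le> (\<integral>\<^sup>+ w. (\<Sum>m<K. \<Sum>n<K. indicator {w. fst w m = snd w n} w)\<^sup>2 \<partial>?Q)"
  proof (intro nn_integral_mono power_mono)
    fix w
    show "J w \<le> (\<Sum>m<K. \<Sum>n<K. indicator {w. fst w m = snd w n} w)"
      unfolding J_def
    proof (rule sum_mono)
      fix m
      have "(\<Sum>n\<in>{N..<K}. indicator (?C m n) w :: ennreal) \<le> (\<Sum>n\<in>{N..<K}. indicator {w. fst w m = snd w n} w)"
        by (rule sum_mono) (simp split: split_indicator)
      also have "\<dots> \<le> (\<Sum>n<K. indicator {w. fst w m = snd w n} w)"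
        by (rule sum_mono2) auto
      finally show "(\<Sum>n\<in>{N..<K}. indicator (?C m n) w :: ennreal) \<le> (\<Sum>n<K. indicator {w. fst w m = snd w n} w)" .
    qed
  qed simp
  also have "\<dots> \<le> 4 * (?S K)\<^sup>2"
    by (rule intersections_second_moment[OF hom])
  also have "(\<integral>\<^sup>+ w. J w * indicator ?T w \<partial>?Q) = (\<integral>\<^sup>+ w. J w \<partial>?Q)"
  proof (rule nn_integral_cong)
    fix w
    have "J w = 0" if "w \<notin> ?T"
      unfolding J_def
    proof (intro sum.neutral ballI)
      fix m n assume "n \<in> {N..<K}"
      then have "w \<notin> ?C m n" using CT[of n m] that by (meson atLeastLessThan_iff subsetD)
      then show "indicator (?C m n) w = (0 :: ennreal)" by (rule indicator_simps(2))
    qed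
    then show "J w * indicator ?T w = J w" by (auto split: split_indicator)
  qed
  finally have "(ennreal e)\<^sup>2 \<le> 4 * (ennreal s)\<^sup>2 * ennreal (Q.prob ?T)"
    by (simp add: EJ s mult_right_mono Q.emeasure_eq_measure)
  then have "ennreal (e\<^sup>2) \<le> ennreal (4 * s\<^sup>2 * Q.prob ?T)"
    using e0 s by (simp add: ennreal_power ennreal_mult)
  then have "e\<^sup>2 \<le> 4 * s\<^sup>2 * Q.prob ?T" by (subst (asm) ennreal_le_iff) auto
  \<comment> \<open>Together \<open>9 * s^2 \<le> 64 * e^2 \<le> 256 * s^2 * Q.prob ?T\<close>, and
    9/256 exceeds 1/32.\<close>
  moreover have "(3 * s)\<^sup>2 \<le> (8 * e)\<^sup>2" using se s by (intro power_mono) auto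
  ultimately have "9 * s\<^sup>2 \<le> s\<^sup>2 * (256 * Q.prob ?T)" by (simp add: power_mult_distrib)
  then have "s\<^sup>2 * 9 \<le> s\<^sup>2 * (256 * Q.prob ?T)" by (simp add: mult.commute)
  then have "9 \<le> 256 * Q.prob ?T" using s1 by (subst (asm) mult_le_cancel_left_pos) auto
  then have "1 / 32 \<le> Q.prob ?T" by simp
  then show ?thesis by (simp add: Q.emeasure_eq_measure ennreal_leI)
qed

definition hits_loop_erasure_io :: "(nat \<Rightarrow> 's) \<Rightarrow> (nat \<Rightarrow> 's) \<Rightarrow> bool" where
  "hits_loop_erasure_io \<xi> \<eta> \<longleftrightarrow> (\<forall>N. \<exists>n\<ge>N. \<eta> n \<in> range (loop_erasure \<xi>))"

lemma pred2_hits_loop_erasure_io [measurable]: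
  "pred2 (hits_loop_erasure_io :: (nat \<Rightarrow> 's :: countable) \<Rightarrow> _)"
proof -
  have [measurable]: "pred2 (\<lambda>(\<xi> :: nat \<Rightarrow> 's) \<eta>. \<eta> n \<in> range (loop_erasure \<xi>))" for n
    by (rule pred_in_range_loop_erasure) measurable
  show ?thesis unfolding hits_loop_erasure_io_def by measurable
qed

text \<open>The bound of \<open>loop_erasure_hit_bound\<close> does not depend on \<open>N\<close>,
  so it passes to the decreasing limit.\<close>

lemma hits_loop_erasure_io_bound:
  fixes p :: "'s :: countable \<Rightarrow> 's pmf"
  assumes hom: "\<And>K y. green_energy p K y = green_energy p K x"
    and unbounded: "(SUP K. green_energy p K x) = \<infinity>"
  shows "ennreal (1 / 32) \<le> emeasure (pair_law p x x) {w. hits_loop_erasure_io (glue k \<omega> (fst w)) (snd w)}"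
proof -
  interpret Q: prob_space "pair_law p x x" by (rule prob_space_pair_law)
  define A where "A N = {w :: (nat \<Rightarrow> 's) \<times> (nat \<Rightarrow> 's). \<exists>n\<ge>N. snd w n \<in> range (loop_erasure (glue k \<omega> (fst w)))}" for N :: nat
  have gl: "(\<lambda>w. glue k \<omega> (fst w)) \<in> measurable (path_space \<Otimes>\<^sub>M path_space) path_space"
    by (rule measurable_glue[OF measurable_const]) (simp add: space_PiM, measurable)
  have "pred2 (\<lambda>\<xi> \<eta>. \<eta> n \<in> range (loop_erasure (glue k \<omega> \<xi>)))" for n
    by (rule pred_in_range_loop_erasure[OF _ gl]) measurable
  then have "pred2 (\<lambda>\<xi> \<eta>. \<exists>n\<ge>N. \<eta> n \<in> range (loop_erasure (glue k \<omega> \<xi>)))" for N by measurable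
  then have A: "A N \<in> sets (pair_law p x x)" for N
    unfolding A_def by (rule Collect_in_sets_pair_law)
  have dec: "decseq A"
    unfolding A_def decseq_def by (auto intro: order_trans)
  have "ennreal (1 / 32) \<le> (INF N. emeasure (pair_law p x x) (A N))"
    unfolding A_def by (intro INF_greatest loop_erasure_hit_bound assms)
  also have "\<dots> = emeasure (pair_law p x x) (\<Inter>N. A N)"
    using A dec by (intro INF_emeasure_decseq) auto
  also have "(\<Inter>N. A N) = {w. hits_loop_erasure_io (glue k \<omega> (fst w)) (snd w)}"
    by (auto simp: A_def hits_loop_erasure_io_def)
  finally show ?thesis .
qed

section \<open>Shifts, permutations and transience for pairs of paths\<close>

lemma loop_erasure_in_range: "loop_erasure v j \<in> range v"
  by (cases j) auto

lemma ex_ge_shift: "(\<forall>N. \<exists>n\<ge>N. P (k + n)) \<longleftrightarrow> (\<forall>N. \<exists>n\<ge>N. P (n :: nat))"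
proof safe
  fix N assume "\<forall>N. \<exists>n\<ge>N. P (k + n)"
  then show "\<exists>n\<ge>N. P n" by (metis trans_le_add2)
next
  fix N assume "\<forall>N. \<exists>n\<ge>N. P n"
  then obtain n where "n \<ge> k + N" "P n" by blast
  then show "\<exists>n\<ge>N. P (k + n)" by (intro exI[of _ "n - k"]) auto
qed

lemma hits_loop_erasure_io_shift: "hits_loop_erasure_io \<xi> (path_shift k \<eta>) = hits_loop_erasure_io \<xi> \<eta>"
  unfolding hits_loop_erasure_io_def path_shift_apply by (rule ex_ge_shift)

lemma meets_io_shift:
  "(\<forall>N. meets_after N (path_shift i \<xi>) (path_shift k \<eta>)) \<longleftrightarrow> (\<forall>N. meets_after N \<xi> \<eta>)"
proof (intro iffI allI)
  fix N assume "\<forall>N. meets_after N (path_shift i \<xi>) (path_shift k \<eta>)"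
  then have "meets_after N (path_shift i \<xi>) (path_shift k \<eta>)" ..
  then obtain m n where "m \<ge> N" "n \<ge> N" "\<xi> (i + m) = \<eta> (k + n)"
    by (auto simp: meets_after_def)
  then show "meets_after N \<xi> \<eta>"
    unfolding meets_after_def by (intro exI[of _ "i + m"] exI[of _ "k + n"] conjI) auto
next
  fix N assume "\<forall>N. meets_after N \<xi> \<eta>"
  \<comment> \<open>Indices this large keep the subtractions \<open>m - i\<close> and
    \<open>n - k\<close> exact and their results at least \<open>N\<close>.\<close>
  then obtain m n where "m \<ge> N + i + k" "n \<ge> N + i + k" "\<xi> m = \<eta> n"
    unfolding meets_after_def by blast
  then show "meets_after N (path_shift i \<xi>) (path_shift k \<eta>)"
    unfolding meets_after_def by (intro exI[of _ "m - i"] exI[of _ "n - k"] conjI) auto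
qed

lemma path_shift_0 [simp]: "path_shift 0 \<omega> = \<omega>"
  by (simp add: path_shift_def)

lemma emeasure_pair_law_permutation:
  fixes p :: "'s :: countable \<Rightarrow> 's pmf"
  assumes "bij \<pi>" and inv: "\<And>x y. pmf (p (\<pi> x)) (\<pi> y) = pmf (p x) y"
    and E: "pred2 E" and E_inv: "\<And>\<xi> \<eta>. E (\<lambda>i. \<pi> (\<xi> i)) (\<lambda>i. \<pi> (\<eta> i)) = E \<xi> \<eta>"
  shows "emeasure (pair_law p (\<pi> x) (\<pi> y)) {w. E (fst w) (snd w)} = emeasure (pair_law p x y) {w. E (fst w) (snd w)}"
proof -
  note d = distr_path_law_permutation[where \<pi>=\<pi> and p=p, OF assms(1,2), symmetric]
  have m: "(\<lambda>\<omega> i. \<pi> (\<omega> i)) \<in> measurable (path_law p x) path_space" for x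
    by (rule measurable_path_spaceI) measurable
  have "emeasure (pair_law p (\<pi> x) (\<pi> y)) {w. E (fst w) (snd w)} =
    (\<integral>\<^sup>+ \<xi>. emeasure (path_law p (\<pi> y)) {\<eta>. E \<xi> \<eta>} \<partial>path_law p (\<pi> x))"
    by (rule emeasure_pair_law_left[OF E])
  also have "\<dots> = (\<integral>\<^sup>+ \<xi>. emeasure (path_law p (\<pi> y)) {\<eta>. E (\<lambda>i. \<pi> (\<xi> i)) \<eta>} \<partial>path_law p x)"
    unfolding d[of x] by (rule nn_integral_distr[OF m]) (simp add: measurable_emeasure_section1[OF E])
  also have "\<dots> = (\<integral>\<^sup>+ \<xi>. emeasure (path_law p y) {\<eta>. E \<xi> \<eta>} \<partial>path_law p x)"
  proof (rule nn_integral_cong)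
    fix \<xi>
    show "emeasure (path_law p (\<pi> y)) {\<eta>. E (\<lambda>i. \<pi> (\<xi> i)) \<eta>} = emeasure (path_law p y) {\<eta>. E \<xi> \<eta>}"
      unfolding d[of y]
      by (subst emeasure_distr[OF m Collect_in_sets_path_space[OF pred2_left[OF E]]])
        (simp add: vimage_def space_path_law E_inv)
  qed
  also have "\<dots> = emeasure (pair_law p x y) {w. E (fst w) (snd w)}"
    by (rule emeasure_pair_law_left[OF E, symmetric])
  finally show ?thesis .
qed

lemma AE_pair_law_transient:
  fixes p :: "'s :: countable \<Rightarrow> 's pmf"
  assumes "transient_kernel p"
  shows "AE w in pair_law p x y. \<forall>z. \<exists>k. \<forall>n\<ge>k. snd w n \<noteq> z"
proof -
  interpret x: prob_space "path_law p x" by (rule prob_space_path_law)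
  interpret y: prob_space "path_law p y" by (rule prob_space_path_law)
  interpret pair_sigma_finite "path_law p x" "path_law p y" ..
  have "AE \<eta> in path_law p y. \<exists>k. \<forall>n\<ge>k. \<eta> n \<noteq> z" for z
    using assms by (intro transient_finitely_many_visits) (simp add: transient_kernel_def)
  then have "AE \<eta> in path_law p y. \<forall>z. \<exists>k. \<forall>n\<ge>k. \<eta> n \<noteq> z"
    by (simp add: AE_all_countable)
  then have *: "AE \<xi> in path_law p x. AE \<eta> in path_law p y. \<forall>z. \<exists>k. \<forall>n\<ge>k. \<eta> n \<noteq> z"
    by (rule AE_I2)
  show ?thesis
    by (rule AE_pair_measure) (measurable, simp only: snd_conv, rule *)
qed

lemma transient_finite_visits:
  assumes "\<forall>z. \<exists>k. \<forall>n\<ge>k. \<eta> (n :: nat) \<noteq> z" "finite F"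
  shows "\<exists>k. \<forall>n\<ge>k. \<eta> n \<notin> F"
  using \<open>finite F\<close>
proof induction
  case (insert z F)
  then obtain k where k: "\<forall>n\<ge>k. \<eta> n \<notin> F" by blast
  obtain l where "\<forall>n\<ge>l. \<eta> n \<noteq> z" using assms(1) by blast
  with k show ?case by (intro exI[of _ "max k l"]) auto
qed simp

text \<open>The second path leaves every finite set of states for good. For the first
  \<open>N\<close> states of \<xi> this pushes the meeting index on \<xi> to at least
  \<open>N\<close>; for the intersection of the ranges it excludes finiteness.\<close>

lemma hits_loop_erasure_io_imp_meets:
  assumes fin: "\<forall>z. \<exists>k. \<forall>n\<ge>k. \<eta> n \<noteq> z" and h: "hits_loop_erasure_io \<xi> \<eta>"
  shows "meets_after N \<xi> \<eta>" "infinite (range \<xi> \<inter> range \<eta>)"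
proof -
  have hit: "\<exists>n\<ge>N. \<eta> n \<in> range \<xi>" for N
  proof -
    obtain n where "n \<ge> N" "\<eta> n \<in> range (loop_erasure \<xi>)"
      using h unfolding hits_loop_erasure_io_def by blast
    then obtain j where "\<eta> n = loop_erasure \<xi> j" by blast
    with \<open>n \<ge> N\<close> show ?thesis using loop_erasure_in_range[of \<xi> j] by metis
  qed
  obtain k where k: "\<forall>n\<ge>k. \<eta> n \<notin> \<xi> ` {..<N}"
    using transient_finite_visits[OF fin, of "\<xi> ` {..<N}"] by auto
  obtain n m where "n \<ge> max k N" "\<eta> n = \<xi> m"
    using hit[of "max k N"] by blast
  moreover from this k have "m \<ge> N" by (metis image_eqI lessThan_iff max.bounded_iff not_le)
  ultimately show "meets_after N \<xi> \<eta>" unfolding meets_after_def by (metis max.bounded_iff)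
  show "infinite (range \<xi> \<inter> range \<eta>)"
  proof
    assume "finite (range \<xi> \<inter> range \<eta>)"
    then obtain k where "\<forall>n\<ge>k. \<eta> n \<notin> range \<xi> \<inter> range \<eta>"
      using transient_finite_visits[OF fin] by blast
    with hit[of k] show False by blast
  qed
qed

theorem pair_law_hits_loop_erasure_io:
  fixes p :: "'s :: countable \<Rightarrow> 's pmf"
  assumes transient: "transient_kernel p"
    and trans: "\<And>y. \<exists>\<pi>. bij \<pi> \<and> (\<forall>a b. pmf (p (\<pi> a)) (\<pi> b) = pmf (p a) b) \<and> \<pi> x = y"
    and green_infinite: "(\<Sum>\<^sub>\<infinity>z. (green p x z)\<^sup>2) = \<infinity>"
  shows "AE w in pair_law p x x. hits_loop_erasure_io (fst w) (snd w) \<and> infinite (range (fst w) \<inter> range (snd w))"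
proof -
  let ?Q = "pair_law p x x"
  interpret Q: prob_space ?Q by (rule prob_space_pair_law)
  let ?M = "\<lambda>\<xi> \<eta>. \<forall>N. meets_after N (\<xi> :: nat \<Rightarrow> 's) \<eta>"
  have M: "pred2 (\<lambda>\<xi> \<eta>. \<not> ?M \<xi> \<eta>)" by measurable
  have energy: "green_energy p K y = green_energy p K y'" for K y y'
  proof -
    have "green_energy p K y = green_energy p K x" for y
      using trans[of y] green_energy_permutation[of _ p K x] by blast
    then show ?thesis by metis
  qed
  have unbounded: "(SUP K. green_energy p K y) = \<infinity>" for y
    using green_energy_unbounded[OF green_infinite] energy[of _ y x] by simp
  have hit: "ennreal (1 / 32) \<le> emeasure (pair_law p y y) {w. hits_loop_erasure_io (glue k \<omega> (fst w)) (snd w)}" for k \<omega> y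
    using energy unbounded by (rule hits_loop_erasure_io_bound)
  have tr: "AE w in ?Q. \<forall>z. \<exists>k. \<forall>n\<ge>k. snd w n \<noteq> z"
    by (rule AE_pair_law_transient[OF transient])
  \<comment> \<open>The probability that the intersections stop. By transitivity it is the same from
    every common starting state.\<close>
  define q where "q = Q.prob {w. \<not> ?M (fst w) (snd w)}"
  have Mq: "emeasure (pair_law p y y) {w. \<not> ?M (fst w) (snd w)} = ennreal q" for y
  proof -
    obtain \<pi> where "bij \<pi>" "\<And>a b. pmf (p (\<pi> a)) (\<pi> b) = pmf (p a) b" "\<pi> x = y"
      using trans by blast
    then have "emeasure (pair_law p y y) {w. \<not> ?M (fst w) (snd w)} = emeasure ?Q {w. \<not> ?M (fst w) (snd w)}"
      using emeasure_pair_law_permutation[of \<pi> p "\<lambda>\<xi> \<eta>. \<not> ?M \<xi> \<eta>" x x] M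
      by (simp add: meets_after_def bij_def inj_eq)
    then show ?thesis by (simp add: q_def Q.emeasure_eq_measure)
  qed
  have "q = 0"
  proof (rule ccontr)
    assume "q \<noteq> 0"
    then have q: "q / 2 > 0" by (simp add: q_def zero_less_measure_iff)
    \<comment> \<open>If \<open>q\<close> were positive, taking \<Phi> to be the failure of
      \<open>?M\<close> would make \<open>?M\<close> fail almost surely. This contradicts the
      positive probability of hitting the loop-erasure infinitely often, which entails
      \<open>?M\<close>.\<close>
    have "AE w in ?Q. ?M (fst w) (snd w) \<longrightarrow> \<not> ?M (fst w) (snd w)"
    proof (rule meets_infinitely_often_imp[OF M _ q])
      show "(\<not> ?M \<xi> (path_shift n \<eta>)) = (\<not> ?M \<xi> \<eta>)" for \<xi> \<eta> n
        using meets_io_shift[of 0 \<xi> n \<eta>] by simp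
      show "2 * ennreal (q / 2) \<le> emeasure (pair_law p (\<omega> m) (\<omega> m)) {z. \<not> ?M (glue m \<omega> (fst z)) (snd z)}" for m \<omega>
      proof -
        \<comment> \<open>A finite prefix does not affect whether there are intersections at
          arbitrarily late times, so the lower bound is \<open>q\<close> itself.\<close>
        have "?M (glue m \<omega> \<xi>) \<eta> = ?M \<xi> \<eta>" for \<xi> \<eta>
          using meets_io_shift[of m "glue m \<omega> \<xi>" 0 \<eta>] by simp
        moreover have "2 * ennreal (q / 2) = ennreal q"
          using q by (simp add: ennreal_mult[of 2 "q / 2", symmetric, simplified])
        ultimately show ?thesis by (simp add: Mq del: not_all)
      qed
    qed
    with tr have "AE w in ?Q. \<not> hits_loop_erasure_io (fst w) (snd w)"
      by eventually_elim (use hits_loop_erasure_io_imp_meets(1) in blast)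
    moreover have "{w. hits_loop_erasure_io (fst w) (snd w)} \<in> sets ?Q"
      by (rule Collect_in_sets_pair_law) measurable
    ultimately have "emeasure ?Q {w. hits_loop_erasure_io (fst w) (snd w)} = 0"
      by (subst (asm) AE_iff_measurable[OF _ refl]) (auto simp: space_pair_law)
    moreover have "glue 0 \<omega> \<xi> = \<xi>" for \<omega> \<xi> :: "nat \<Rightarrow> 's"
      by (simp add: glue_def)
    ultimately show False
      using hit[of x 0] by simp
  qed
  then have meets: "AE w in ?Q. ?M (fst w) (snd w)"
    using Mq[of x] Collect_in_sets_pair_law[OF M, of p x x]
    by (subst AE_iff_measurable[OF _ refl]) (auto simp: space_pair_law)
  \<comment> \<open>Second use of the transfer, with \<open>c\<close> equal to 1/64, half of the
    bound in \<open>hit\<close>.\<close>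
  have "AE w in ?Q. ?M (fst w) (snd w) \<longrightarrow> hits_loop_erasure_io (fst w) (snd w)"
  proof (rule meets_infinitely_often_imp[OF pred2_hits_loop_erasure_io hits_loop_erasure_io_shift])
    show "(1 / 64 :: real) > 0" by simp
    have "2 * ennreal (1 / 64) = ennreal (1 / 32)"
      using ennreal_mult[of 2 "1 / 64"] by simp
    then show "2 * ennreal (1 / 64) \<le> emeasure (pair_law p (\<omega> m) (\<omega> m)) {z. hits_loop_erasure_io (glue m \<omega> (fst z)) (snd z)}" for m \<omega>
      using hit by simp
  qed
  with meets tr show ?thesis
    by eventually_elim (use hits_loop_erasure_io_imp_meets(2) in blast)
qed

theorem theorem1p4:
  fixes p :: "'s :: countable \<Rightarrow> 's pmf"
    and \<Gamma> :: "('s \<Rightarrow> 's) set"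
    and x\<^sub>0 :: 's
    and M :: "'w measure"
    and X Y :: "nat \<Rightarrow> 'w \<Rightarrow> 's"
  assumes transient: "transient_kernel p"
    and group: "subgroup \<Gamma> (BijGroup UNIV)"
    and transitive: "\<forall>x y. \<exists>\<pi>\<in>\<Gamma>. \<pi> x = y"
    and invariant: "\<forall>\<pi>\<in>\<Gamma>. \<forall>x y. pmf (p (\<pi> x)) (\<pi> y) = pmf (p x) y"
    and green_infinite: "(\<Sum>\<^sub>\<infinity>z. (green p x\<^sub>0 z)\<^sup>2) = \<infinity>"
    and prob_space: "prob_space M"
    and X: "markov_chain M p x\<^sub>0 X"
    and Y: "markov_chain M p x\<^sub>0 Y"
    and indep: "prob_space.indep_var M
                  path_space (\<lambda>\<omega> m. X m \<omega>) path_space (\<lambda>\<omega> n. Y n \<omega>)"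
  shows "(AE \<omega> in M. infinite (range (\<lambda>m. X m \<omega>) \<inter> range (\<lambda>n. Y n \<omega>))) \<and>
         (AE \<omega> in M. infinite {n. Y n \<omega> \<in> range (loop_erasure (\<lambda>m. X m \<omega>))})"
proof -
  note prob_space_M = prob_space
  interpret prob_space M by (rule prob_space)
  have "bij \<pi>" if "\<pi> \<in> \<Gamma>" for \<pi>
    using subgroup.mem_carrier[OF group that] by (simp add: BijGroup_def Bij_def)
  then have trans: "\<exists>\<pi>. bij \<pi> \<and> (\<forall>a b. pmf (p (\<pi> a)) (\<pi> b) = pmf (p a) b) \<and> \<pi> x\<^sub>0 = y" for y
    using transitive invariant by metis
  have mX: "(\<lambda>\<omega> m. X m \<omega>) \<in> measurable M path_space" and mY: "(\<lambda>\<omega> m. Y m \<omega>) \<in> measurable M path_space"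
    using indep by (auto dest: indep_var_rv1 indep_var_rv2)
  \<comment> \<open>Independence makes the joint law a product and uniqueness in law identifies both
    factors, which reduces the claim to the canonical pair of paths.\<close>
  have distr_eq: "distr M (path_space \<Otimes>\<^sub>M path_space) (\<lambda>\<omega>. (\<lambda>m. X m \<omega>, \<lambda>n. Y n \<omega>)) = pair_law p x\<^sub>0 x\<^sub>0"
    using indep unfolding indep_var_distribution_eq
    by (simp add: distr_markov_chain[OF prob_space_M X] distr_markov_chain[OF prob_space_M Y])
  have "AE w in distr M (path_space \<Otimes>\<^sub>M path_space) (\<lambda>\<omega>. (\<lambda>m. X m \<omega>, \<lambda>n. Y n \<omega>)).
      hits_loop_erasure_io (fst w) (snd w) \<and> infinite (range (fst w) \<inter> range (snd w))"
    unfolding distr_eq by (rule pair_law_hits_loop_erasure_io[OF transient trans green_infinite])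
  then have "AE \<omega> in M. hits_loop_erasure_io (\<lambda>m. X m \<omega>) (\<lambda>n. Y n \<omega>) \<and>
      infinite (range (\<lambda>m. X m \<omega>) \<inter> range (\<lambda>n. Y n \<omega>))"
    by (rule AE_distrD[OF measurable_Pair[OF mX mY], THEN eventually_mono]) simp
  then show ?thesis
    by (auto simp: hits_loop_erasure_io_def infinite_nat_iff_unbounded_le elim!: eventually_mono)
qed

end
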